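(* Under the setting and standing assumptions of the context, let $(\bar x,\bar y)\in\mathbb R^n\times\mathbb R^m$ and suppose that the sequences $\{(x^k,y^k,z^k)\}\subset\mathbb R^{n+m+q}$, $\{\varepsilon^k\}\subset\mathbb R^{n+m+q}$ and $\{\rho^k\}\subset(0,\infty)$ satisfy $$(x^k,y^k)\to(\bar x,\bar y),\quad \varepsilon^k\to0,\quad (x^k,y^k,z^k)\in\Omega\times\mathbb R^q_+\ \ \forall k,\quad \mathcal G_\gamma(x^k,y^k,z^k)\to0,$$ $$\varepsilon^k\in\nabla F(x^k,y^k)+\rho^k\nabla\mathcal G_\gamma(x^k,y^k,z^k)+\mathcal N_{\Omega\times\mathbb R^q_+}(x^k,y^k,z^k)\quad\forall k,$$ where $\nabla F(x^k,y^k)$ is regarded as a vector in $\mathbb R^{n+m+q}$ with zero $z$-component. Assume that MFCQ holds at $\bar y$ for the system $\{y\mid g(\bar x,y)\le0\}$ and that MFCQ holds at $(\bar x,\bar y)$ for the system $\{(x,y)\mid G(x,y)\le0\}$. Let $\bar z\in\mathbb R^q_+$ be any accumulation point of $\{z^k\}$ and put $\bar w:=(\bar x,\bar y,\bar z)$. Then: 1. If $\{\rho^k\}$ is bounded, then $\bar w$ is S-stationary for the MPCC. 2. If $\rho^k\to+\infty$ and, in addition, MPCC-MFCQ holds at $\bar w$ for the MPCC, then $\bar w$ is C-stationary for the MPCC.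
   Context: Setting. $F,f:\mathbb R^n\times\mathbb R^m\to\mathbb R$, $G=(G_1,\dots,G_p):\mathbb R^n\times\mathbb R^m\to\mathbb R^p$, $g=(g_1,\dots,g_q):\mathbb R^n\times\mathbb R^m\to\mathbb R^q$; $\Omega:=\{(x,y)\mid G(x,y)\le0\}$ and $X:=\{x\in\mathbb R^n\mid\exists y\in\mathbb R^m:(x,y)\in\Omega\}$. Vector inequalities are componentwise. Standing assumptions. $F$ is continuously differentiable on an open set containing $\Omega$; each $G_i$ is continuously differentiable and convex on an open set containing $\Omega$. For every $x\in X$, $f(x,\cdot)$ and $g_i(x,\cdot)$ ($i=1,\dots,q$) are convex on $\mathbb R^m$; $f$ and all $g_i$ are twice continuously differentiable on an open set containing $X\times\mathbb R^m$. Regularized gap function. $\mathcal L(x,y,z):=f(x,y)+z^\top g(x,y)$. Fix $\gamma=(\gamma_1,\gamma_2)$ with $\gamma_1,\gamma_2>0$. For $(x,y,z)\in\Omega\times\mathbb R^q_+$, $$\mathcal G_\gamma(x,y,z):=\max_{\theta\in\mathbb R^m,\ \lambda\in\mathbb R^q_+}\Big\{\mathcal L(x,y,\lambda)-\tfrac1{2\gamma_2}\|\lambda-z\|^2-\mathcal L(x,\theta,z)-\tfrac1{2\gamma_1}\|\theta-y\|^2\Big\}.$$ Put $\theta^*=\theta^*(x,y,z):=\operatorname{argmin}_{\theta\in\mathbb R^m}\{f(x,\theta)+z^\top g(x,\theta)+\tfrac1{2\gamma_1}\|\theta-y\|^2\}$ (unique) and $\lambda^*=\lambda^*(x,y,z):=\operatorname{Proj}_{\mathbb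 R^q_+}(z+\gamma_2g(x,y))$. $\mathcal G_\gamma$ is continuously differentiable on $\Omega\times\mathbb R^q_+$ with gradient (components in $x,y,z$) $$\nabla\mathcal G_\gamma(x,y,z)=\begin{pmatrix}\nabla_xf(x,y)+\nabla_xg(x,y)^\top\lambda^*-\nabla_xf(x,\theta^* )-\nabla_xg(x,\theta^* )^\top z\\ \nabla_yf(x,y)+\nabla_yg(x,y)^\top\lambda^*-(y-\theta^* )/\gamma_1\\ -(z-\lambda^* )/\gamma_2-g(x,\theta^* )\end{pmatrix}.$$ Notation. $\nabla g,\nabla G$ are Jacobians; $\nabla_yg_i\in\mathbb R^m$ is the gradient in $y$; $\nabla_{x,y}\mathcal L\in\mathbb R^{n+m}$ is the gradient in $(x,y)$ and $\nabla_y\nabla_{x,y}\mathcal L$ is its $(n+m)\times m$ Jacobian in $y$. $\mathcal N_D$ is the limiting (Mordukhovich) normal cone to a closed set $D$ (the usual normal cone if $D$ is convex). MFCQ. For a system $\{w\mid h(w)=0,\ c(w)\le0\}$ with continuously differentiable $h,c$, MFCQ holds at a feasible point $\bar w$ if $\sum_j\mu^h_j\nabla h_j(\bar w)+\sum_{i:c_i(\bar w)=0}\mu^c_i\nabla c_i(\bar w)=0$ with $\mu^h_j\in\mathbb R$, $\mu^c_i\ge0$ implies that all these multipliers vanish. The MPCC is $$\min_{x,y,z}\ F(x,y)\quad\text{s.t. } G(x,y)\le0,\ \nabla_y\mathcal L(x,y,z)=0,\ 0\le z\perp-g(x,y)\ge0.$$ For a feasible $\bar w=(\bar x,\bar y,\bar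 z)$ let $\mathcal I_{+0}=\{i\mid\bar z_i>0,g_i(\bar x,\bar y)=0\}$, $\mathcal I_{0+}=\{i\mid\bar z_i=0,g_i(\bar x,\bar y)<0\}$, $\mathcal I_{00}=\{i\mid\bar z_i=0,g_i(\bar x,\bar y)=0\}$. MPCC-MFCQ holds at $\bar w$ if MFCQ holds at $\bar w$ for the system in $(x,y,z)$: $G(x,y)\le0$; $\nabla_y\mathcal L(x,y,z)=0$; $-g_i(x,y)=0$ ($i\in\mathcal I_{+0}\cup\mathcal I_{00}$); $z_i=0$ ($i\in\mathcal I_{0+}\cup\mathcal I_{00}$); $-g_i(x,y)\ge0$ ($i\in\mathcal I_{0+}$); $z_i\ge0$ ($i\in\mathcal I_{+0}$). Stationarity. A feasible $\bar w$ of the MPCC is S-stationary (resp. C-stationary) if there exist $\mu\in\mathbb R^p_+$, $\omega\in\mathbb R^m$, $\eta\in\mathbb R^q$ with $$0=\nabla F(\bar x,\bar y)+\nabla G(\bar x,\bar y)^\top\mu+\nabla_y\nabla_{x,y}\mathcal L(\bar x,\bar y,\bar z)\,\omega+\nabla g(\bar x,\bar y)^\top\eta,$$ $\mu_jG_j(\bar x,\bar y)=0$ for all $j$, $\eta_i=0$ for $i\in\mathcal I_{0+}$, $\nabla_yg_i(\bar x,\bar y)^\top\omega=0$ for $i\in\mathcal I_{+0}$, and, for every $i\in\mathcal I_{00}$: $\eta_i\ge0$ and $\nabla_yg_i(\bar x,\bar y)^\top\omega\ge0$ (S-stationary); resp. $\eta_i\,\nabla_yg_i(\bar x,\bar y)^\top\omega\ge0$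 (C-stationary). *)

theory Defs
  imports "HOL-Analysis.Analysis"
begin

section \<open>Calculus\<close>

definition grad :: "('a::real_inner \<Rightarrow> real) \<Rightarrow> 'a \<Rightarrow> 'a" where
  "grad h a = (THE D. GDERIV h a :> D)"

text \<open>The transposed Jacobian of \<open>h\<close> at \<open>a\<close> applied to \<open>v\<close>; its columns are the gradients
  of the components of \<open>h\<close>.\<close>

definition jacT :: "('a::real_inner \<Rightarrow> real^'k) \<Rightarrow> 'a \<Rightarrow> real^'k \<Rightarrow> 'a" where
  "jacT h a v = (\<Sum>i\<in>UNIV. (v $ i) *\<^sub>R grad (\<lambda>a. h a $ i) a)"

definition cont_diff_on :: "'a::real_normed_vector set \<Rightarrow> ('a \<Rightarrow> 'b::real_normed_vector) \<Rightarrow> bool" where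
  "cont_diff_on U h \<longleftrightarrow>
     (\<exists>D :: 'a \<Rightarrow> 'a \<Rightarrow>\<^sub>L 'b.
        (\<forall>a\<in>U. (h has_derivative blinfun_apply (D a)) (at a)) \<and> continuous_on U D)"

definition twice_cont_diff_on :: "'a::real_inner set \<Rightarrow> ('a \<Rightarrow> real) \<Rightarrow> bool" where
  "twice_cont_diff_on U h \<longleftrightarrow> cont_diff_on U h \<and> cont_diff_on U (grad h)"

section \<open>Normal cones\<close>

definition frechet_normal_cone :: "'a::real_inner set \<Rightarrow> 'a \<Rightarrow> 'a set" where
  "frechet_normal_cone D a =
     (if a \<in> D
      then {v. \<forall>e>0. \<forall>\<^sub>F b in at a within D. v \<bullet> (b - a) \<le> e * norm (b - a)}
      else {})"

definition limiting_normal_cone :: "'a::real_inner set \<Rightarrow> 'a \<Rightarrow> 'a set" where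
  "limiting_normal_cone D a =
     (if a \<in> D
      then {v. \<exists>b u. (\<forall>k. b k \<in> D \<and> u k \<in> frechet_normal_cone D (b k)) \<and>
                     b \<longlonglongrightarrow> a \<and> u \<longlonglongrightarrow> v}
      else {})"

section \<open>The lower-level data and the regularized gap function\<close>

text \<open>The order on \<^typ>\<open>real^'k\<close> is the componentwise one, so \<open>{0..}\<close> is the
  nonnegative orthant.\<close>

definition Omega :: "((real^'n) \<times> (real^'m) \<Rightarrow> real^'p) \<Rightarrow> ((real^'n) \<times> (real^'m)) set" where
  "Omega G = {(x, y). G (x, y) \<le> 0}"

definition X_set :: "((real^'n) \<times> (real^'m) \<Rightarrow> real^'p) \<Rightarrow> (real^'n) set" where
  "X_set G = {x. \<exists>y. (x, y) \<in> Omega G}"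

definition Omega_plus ::
  "((real^'n) \<times> (real^'m) \<Rightarrow> real^'p) \<Rightarrow> ((real^'n) \<times> (real^'m) \<times> (real^'q)) set" where
  "Omega_plus G = {(x, y, z). (x, y) \<in> Omega G \<and> z \<in> {0..}}"

definition lagr ::
  "((real^'n) \<times> (real^'m) \<Rightarrow> real) \<Rightarrow> ((real^'n) \<times> (real^'m) \<Rightarrow> real^'q) \<Rightarrow>
   real^'n \<Rightarrow> real^'m \<Rightarrow> real^'q \<Rightarrow> real" where
  "lagr f g x y z = f (x, y) + z \<bullet> g (x, y)"

text \<open>For \<open>x \<in> X_set G\<close> and \<open>z \<ge> 0\<close> the lower-level convexity makes the objective strongly concave in
  \<open>(\<theta>, l)\<close>, so the supremum is a (uniquely attained) maximum.\<close>

definition gap ::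
  "((real^'n) \<times> (real^'m) \<Rightarrow> real) \<Rightarrow> ((real^'n) \<times> (real^'m) \<Rightarrow> real^'q) \<Rightarrow>
   real \<Rightarrow> real \<Rightarrow> (real^'n) \<times> (real^'m) \<times> (real^'q) \<Rightarrow> real" where
  "gap f g \<gamma>1 \<gamma>2 = (\<lambda>(x, y, z).
     SUP (\<theta>, l) \<in> UNIV \<times> {0..}.
       lagr f g x y l - 1 / (2 * \<gamma>2) * (norm (l - z))\<^sup>2
       - lagr f g x \<theta> z - 1 / (2 * \<gamma>1) * (norm (\<theta> - y))\<^sup>2)"

definition theta_star ::
  "((real^'n) \<times> (real^'m) \<Rightarrow> real) \<Rightarrow> ((real^'n) \<times> (real^'m) \<Rightarrow> real^'q) \<Rightarrow>
   real \<Rightarrow> real^'n \<Rightarrow> real^'m \<Rightarrow> real^'q \<Rightarrow> real^'m" where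
  "theta_star f g \<gamma>1 x y z =
     arg_min_on (\<lambda>\<theta>. f (x, \<theta>) + z \<bullet> g (x, \<theta>) + 1 / (2 * \<gamma>1) * (norm (\<theta> - y))\<^sup>2) UNIV"

definition lambda_star ::
  "((real^'n) \<times> (real^'m) \<Rightarrow> real^'q) \<Rightarrow> real \<Rightarrow> real^'n \<Rightarrow> real^'m \<Rightarrow> real^'q \<Rightarrow> real^'q" where
  "lambda_star g \<gamma>2 x y z = closest_point {0..} (z + \<gamma>2 *\<^sub>R g (x, y))"

text \<open>The gradient of \<^const>\<open>gap\<close> on \<^const>\<open>Omega_plus\<close>. It is given by its closed formula
  because it is needed at boundary points: there \<^const>\<open>gap\<close> need not be a finite maximum in a
  neighbourhood, and a derivative relative to the set need not be unique.\<close>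

definition gap_grad ::
  "((real^'n) \<times> (real^'m) \<Rightarrow> real) \<Rightarrow> ((real^'n) \<times> (real^'m) \<Rightarrow> real^'q) \<Rightarrow>
   real \<Rightarrow> real \<Rightarrow> (real^'n) \<times> (real^'m) \<times> (real^'q) \<Rightarrow> (real^'n) \<times> (real^'m) \<times> (real^'q)" where
  "gap_grad f g \<gamma>1 \<gamma>2 = (\<lambda>(x, y, z).
     let \<theta> = theta_star f g \<gamma>1 x y z; l = lambda_star g \<gamma>2 x y z in
     (grad (\<lambda>x'. f (x', y)) x + jacT (\<lambda>x'. g (x', y)) x l
        - grad (\<lambda>x'. f (x', \<theta>)) x - jacT (\<lambda>x'. g (x', \<theta>)) x z,
      grad (\<lambda>y'. f (x, y')) y + jacT (\<lambda>y'. g (x, y')) y l - (1 / \<gamma>1) *\<^sub>R (y - \<theta>),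
      - ((1 / \<gamma>2) *\<^sub>R (z - l)) - g (x, \<theta>)))"

section \<open>Constraint qualifications\<close>

text \<open>MFCQ at \<open>w\<close> for the system \<open>h j = 0\<close> (\<open>j \<in> J\<close>), \<open>c i \<le> 0\<close> (\<open>i \<in> I\<close>),
  with finite index sets \<open>J\<close> and \<open>I\<close>.\<close>

definition mfcq ::
  "'j set \<Rightarrow> ('j \<Rightarrow> 'w::real_inner \<Rightarrow> real) \<Rightarrow> 'i set \<Rightarrow> ('i \<Rightarrow> 'w \<Rightarrow> real) \<Rightarrow> 'w \<Rightarrow> bool" where
  "mfcq J h I c w \<longleftrightarrow>
     (\<forall>j\<in>J. h j w = 0) \<and> (\<forall>i\<in>I. c i w \<le> 0) \<and>
     (\<forall>\<mu>h \<mu>c.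
        (\<forall>i\<in>{i\<in>I. c i w = 0}. \<mu>c i \<ge> 0) \<and>
        (\<Sum>j\<in>J. \<mu>h j *\<^sub>R grad (h j) w) + (\<Sum>i\<in>{i\<in>I. c i w = 0}. \<mu>c i *\<^sub>R grad (c i) w) = 0
        \<longrightarrow> (\<forall>j\<in>J. \<mu>h j = 0) \<and> (\<forall>i\<in>{i\<in>I. c i w = 0}. \<mu>c i = 0))"

definition mfcq_ineq :: "('w::real_inner \<Rightarrow> real^'k) \<Rightarrow> 'w \<Rightarrow> bool" where
  "mfcq_ineq c w \<longleftrightarrow> mfcq ({} :: unit set) (\<lambda>_ _. 0) UNIV (\<lambda>i w. c w $ i) w"

section \<open>The MPCC\<close>

definition mpcc_feasible ::
  "((real^'n) \<times> (real^'m) \<Rightarrow> real) \<Rightarrow> ((real^'n) \<times> (real^'m) \<Rightarrow> real^'p) \<Rightarrow>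
   ((real^'n) \<times> (real^'m) \<Rightarrow> real^'q) \<Rightarrow> (real^'n) \<times> (real^'m) \<times> (real^'q) \<Rightarrow> bool" where
  "mpcc_feasible f G g = (\<lambda>(x, y, z).
     G (x, y) \<le> 0 \<and> grad (\<lambda>y'. lagr f g x y' z) y = 0 \<and>
     0 \<le> z \<and> 0 \<le> - g (x, y) \<and> z \<bullet> (- g (x, y)) = 0)"

definition I_p0 ::
  "((real^'n) \<times> (real^'m) \<Rightarrow> real^'q) \<Rightarrow> (real^'n) \<times> (real^'m) \<times> (real^'q) \<Rightarrow> 'q set" where
  "I_p0 g = (\<lambda>(x, y, z). {i. z $ i > 0 \<and> g (x, y) $ i = 0})"

definition I_0p ::
  "((real^'n) \<times> (real^'m) \<Rightarrow> real^'q) \<Rightarrow> (real^'n) \<times> (real^'m) \<times> (real^'q) \<Rightarrow> 'q set" where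
  "I_0p g = (\<lambda>(x, y, z). {i. z $ i = 0 \<and> g (x, y) $ i < 0})"

definition I_00 ::
  "((real^'n) \<times> (real^'m) \<Rightarrow> real^'q) \<Rightarrow> (real^'n) \<times> (real^'m) \<times> (real^'q) \<Rightarrow> 'q set" where
  "I_00 g = (\<lambda>(x, y, z). {i. z $ i = 0 \<and> g (x, y) $ i = 0})"

text \<open>The index sets are evaluated at the reference point \<open>w\<close> and are fixed in the system.
  The constraints \<open>- g\<^sub>i \<ge> 0\<close> and \<open>z\<^sub>i \<ge> 0\<close> are written as \<open>g\<^sub>i \<le> 0\<close> and \<open>- z\<^sub>i \<le> 0\<close>.\<close>

definition mpcc_mfcq ::
  "((real^'n) \<times> (real^'m) \<Rightarrow> real) \<Rightarrow> ((real^'n) \<times> (real^'m) \<Rightarrow> real^'p) \<Rightarrow>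
   ((real^'n) \<times> (real^'m) \<Rightarrow> real^'q) \<Rightarrow> (real^'n) \<times> (real^'m) \<times> (real^'q) \<Rightarrow> bool" where
  "mpcc_mfcq f G g w \<longleftrightarrow>
     mfcq
       ((UNIV :: 'm set) <+> ((I_p0 g w \<union> I_00 g w) <+> (I_0p g w \<union> I_00 g w)))
       (case_sum (\<lambda>j (x, y, z). grad (\<lambda>y'. lagr f g x y' z) y $ j)
          (case_sum (\<lambda>i (x, y, z). - (g (x, y) $ i)) (\<lambda>i (x, y, z). z $ i)))
       ((UNIV :: 'p set) <+> (I_0p g w <+> I_p0 g w))
       (case_sum (\<lambda>j (x, y, z). G (x, y) $ j)
          (case_sum (\<lambda>i (x, y, z). g (x, y) $ i) (\<lambda>i (x, y, z). - (z $ i))))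
       w"

text \<open>The conditions shared by S- and C-stationarity. The derivative in \<open>y\<close> of
  \<open>\<nabla>\<^sub>x\<^sub>,\<^sub>y L (x, \<cdot>, z)\<close> is applied to \<open>\<omega>\<close>.\<close>

definition mpcc_multiplier ::
  "((real^'n) \<times> (real^'m) \<Rightarrow> real) \<Rightarrow> ((real^'n) \<times> (real^'m) \<Rightarrow> real) \<Rightarrow>
   ((real^'n) \<times> (real^'m) \<Rightarrow> real^'p) \<Rightarrow> ((real^'n) \<times> (real^'m) \<Rightarrow> real^'q) \<Rightarrow>
   (real^'n) \<times> (real^'m) \<times> (real^'q) \<Rightarrow> real^'p \<Rightarrow> real^'m \<Rightarrow> real^'q \<Rightarrow> bool" where
  "mpcc_multiplier F f G g = (\<lambda>(x, y, z) \<mu> \<omega> \<eta>.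
     0 \<le> \<mu> \<and>
     0 = grad F (x, y) + jacT G (x, y) \<mu>
         + frechet_derivative (\<lambda>y'. grad (\<lambda>(x'', y''). lagr f g x'' y'' z) (x, y')) (at y) \<omega>
         + jacT g (x, y) \<eta> \<and>
     (\<forall>j. \<mu> $ j * G (x, y) $ j = 0) \<and>
     (\<forall>i\<in>I_0p g (x, y, z). \<eta> $ i = 0) \<and>
     (\<forall>i\<in>I_p0 g (x, y, z). grad (\<lambda>y'. g (x, y') $ i) y \<bullet> \<omega> = 0))"

definition S_stationary ::
  "((real^'n) \<times> (real^'m) \<Rightarrow> real) \<Rightarrow> ((real^'n) \<times> (real^'m) \<Rightarrow> real) \<Rightarrow>
   ((real^'n) \<times> (real^'m) \<Rightarrow> real^'p) \<Rightarrow> ((real^'n) \<times> (real^'m) \<Rightarrow> real^'q) \<Rightarrow>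
   (real^'n) \<times> (real^'m) \<times> (real^'q) \<Rightarrow> bool" where
  "S_stationary F f G g = (\<lambda>(x, y, z).
     mpcc_feasible f G g (x, y, z) \<and>
     (\<exists>\<mu> \<omega> \<eta>. mpcc_multiplier F f G g (x, y, z) \<mu> \<omega> \<eta> \<and>
        (\<forall>i\<in>I_00 g (x, y, z). \<eta> $ i \<ge> 0 \<and> grad (\<lambda>y'. g (x, y') $ i) y \<bullet> \<omega> \<ge> 0)))"

definition C_stationary ::
  "((real^'n) \<times> (real^'m) \<Rightarrow> real) \<Rightarrow> ((real^'n) \<times> (real^'m) \<Rightarrow> real) \<Rightarrow>
   ((real^'n) \<times> (real^'m) \<Rightarrow> real^'p) \<Rightarrow> ((real^'n) \<times> (real^'m) \<Rightarrow> real^'q) \<Rightarrow>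
   (real^'n) \<times> (real^'m) \<times> (real^'q) \<Rightarrow> bool" where
  "C_stationary F f G g = (\<lambda>(x, y, z).
     mpcc_feasible f G g (x, y, z) \<and>
     (\<exists>\<mu> \<omega> \<eta>. mpcc_multiplier F f G g (x, y, z) \<mu> \<omega> \<eta> \<and>
        (\<forall>i\<in>I_00 g (x, y, z). \<eta> $ i * (grad (\<lambda>y'. g (x, y') $ i) y \<bullet> \<omega>) \<ge> 0)))"

end

theory Submission
  imports Defs
begin

text \<open>
  The gap function dominates the squared distances from \<open>\<theta>\<^sup>*\<close> to \<open>y\<close> and from \<open>\<lambda>\<^sup>*\<close> to \<open>z\<close>, so both
  distances vanish in the limit, and the optimality conditions of \<open>\<theta>\<^sup>*\<close> and \<open>\<lambda>\<^sup>*\<close> turn into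
  feasibility of the limit point. Since \<open>(y - \<theta>\<^sup>*) / \<gamma>\<^sub>1\<close> is the \<open>y\<close>-gradient of the Lagrangian at
  \<open>(x, \<theta>\<^sup>*, z)\<close>, the \<open>(x, y)\<close>-part of \<open>\<rho> \<nabla>\<G>\<close> is \<open>\<rho>\<close> times the difference of the \<open>(x, y)\<close>-gradients of the
  Lagrangian at \<open>(x, y, \<lambda>\<^sup>*)\<close> and \<open>(x, \<theta>\<^sup>*, z)\<close>. Strict differentiability therefore makes it
  behave like a Hessian applied to \<open>\<omega> = \<rho> (y - \<theta>\<^sup>*)\<close> plus \<open>\<nabla>g\<^sup>T \<eta>\<close> with \<open>\<eta> = \<rho> (\<lambda>\<^sup>* - z)\<close>.
  If \<open>\<rho>\<close> is bounded, then \<open>\<omega>\<close> and \<open>\<eta>\<close> tend to \<open>0\<close>. If \<open>\<rho>\<close> tends to infinity, the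
  vector \<open>(\<mu>, \<omega>, \<eta>)\<close> is divided by the maximum of \<open>1\<close> and its norm: a subsequence converges, and
  MPCC-MFCQ excludes that the scaling factor tends to \<open>0\<close>, because the Hessian is symmetric. The sign conditions
  come from the \<open>z\<close>-part, by cases on which branch of the projection defines \<open>\<lambda>\<^sup>*\<close>.
\<close>

section \<open>Gradients and second derivatives\<close>

text \<open>\<open>grad\<close> is a definite description, so it becomes usable only through
  uniqueness: two gradients induce the same functional, and evaluating both at their difference
  gives zero.\<close>

lemma grad_eqI: "GDERIV h a :> D \<Longrightarrow> grad h a = D"
  unfolding grad_def
proof (rule the_equality)
  show "D' = D" if "GDERIV h a :> D" "GDERIV h a :> D'" for D'
  proof -
    have "(\<lambda>v. v \<bullet> D') = (\<lambda>v. v \<bullet> D)"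
      using that unfolding gderiv_def by (rule has_derivative_unique[rotated])
    then have "(D' - D) \<bullet> (D' - D) = 0"
      by (metis inner_diff_right right_minus_eq)
    then show ?thesis by simp
  qed
qed

text \<open>The Riesz representative of a derivative, written in the standard basis. It turns the
  operator-valued derivatives of \<open>cont_diff_on\<close> into gradients.\<close>

lemma has_derivative_GDERIV:
  fixes h :: "'a::euclidean_space \<Rightarrow> real"
  assumes "(h has_derivative D) (at a)"
  shows "GDERIV h a :> (\<Sum>b\<in>Basis. D b *\<^sub>R b)"
proof -
  have "D = (\<lambda>v. v \<bullet> (\<Sum>b\<in>Basis. D b *\<^sub>R b))"
  proof
    fix v
    interpret bounded_linear D using assms by (rule has_derivative_bounded_linear)
    have "D v = D (\<Sum>b\<in>Basis. (v \<bullet> b) *\<^sub>R b)" by (simp add: euclidean_representation)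
    also have "\<dots> = v \<bullet> (\<Sum>b\<in>Basis. D b *\<^sub>R b)"
      by (simp add: sum scaleR inner_sum_right mult.commute)
    finally show "D v = v \<bullet> (\<Sum>b\<in>Basis. D b *\<^sub>R b)" .
  qed
  then show ?thesis unfolding gderiv_def by (rule has_derivative_eq_rhs[OF assms])
qed

lemma cont_diff_on_subset: "cont_diff_on U h \<Longrightarrow> V \<subseteq> U \<Longrightarrow> cont_diff_on V h"
  unfolding cont_diff_on_def by (meson continuous_on_subset subsetD)

lemma cont_diff_on_has_derivative:
  "cont_diff_on U h \<Longrightarrow> a \<in> U \<Longrightarrow> \<exists>D. (h has_derivative D) (at a)"
  unfolding cont_diff_on_def by blast

lemma cont_diff_on_isCont: "cont_diff_on U h \<Longrightarrow> a \<in> U \<Longrightarrow> isCont h a"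
  using cont_diff_on_has_derivative has_derivative_continuous by blast

lemma cont_diff_on_GDERIV:
  fixes h :: "'a::euclidean_space \<Rightarrow> real"
  assumes "cont_diff_on U h" "a \<in> U"
  shows "GDERIV h a :> grad h a"
  using cont_diff_on_has_derivative[OF assms] has_derivative_GDERIV grad_eqI by metis

text \<open>\<open>cont_diff_on\<close> provides continuity of an operator-valued derivative; the
  basis formula for the gradient transfers it to \<open>grad h\<close>.\<close>

lemma cont_diff_on_isCont_grad:
  fixes h :: "'a::euclidean_space \<Rightarrow> real"
  assumes "open U" "cont_diff_on U h" "a \<in> U"
  shows "isCont (grad h) a"
proof -
  obtain D :: "'a \<Rightarrow> 'a \<Rightarrow>\<^sub>L real"
    where D: "\<And>a. a \<in> U \<Longrightarrow> (h has_derivative D a) (at a)" and cD: "continuous_on U D"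
    using assms(2) unfolding cont_diff_on_def by blast
  have "continuous_on U (\<lambda>a. \<Sum>b\<in>Basis. D a b *\<^sub>R b)"
    by (intro continuous_intros cD)
  moreover have "grad h a = (\<Sum>b\<in>Basis. D a b *\<^sub>R b)" if "a \<in> U" for a
    using D[OF that] by (intro grad_eqI has_derivative_GDERIV)
  ultimately have "continuous_on U (grad h)"
    by (metis (no_types, lifting) continuous_on_cong)
  with assms show ?thesis by (simp add: continuous_on_eq_continuous_at)
qed

lemma GDERIV_fst_section:
  assumes "GDERIV h (x, y) :> D"
  shows "GDERIV (\<lambda>x'. h (x', y)) x :> fst D"
proof -
  have "((\<lambda>x'. h (x', y)) has_derivative (\<lambda>v. (v, 0) \<bullet> D)) (at x)"
  proof (rule has_derivative_compose[where f = "\<lambda>x'. (x', y)" and g = h])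
    show "((\<lambda>x'. (x', y)) has_derivative (\<lambda>v. (v, 0))) (at x)"
      by (auto intro!: derivative_eq_intros)
    show "(h has_derivative (\<lambda>w. w \<bullet> D)) (at (x, y))"
      using assms by (simp add: gderiv_def)
  qed
  then show ?thesis unfolding gderiv_def by (simp add: inner_prod_def)
qed

lemma GDERIV_snd_section:
  assumes "GDERIV h (x, y) :> D"
  shows "GDERIV (\<lambda>y'. h (x, y')) y :> snd D"
proof -
  have "((\<lambda>y'. h (x, y')) has_derivative (\<lambda>v. (0, v) \<bullet> D)) (at y)"
  proof (rule has_derivative_compose[where f = "\<lambda>y'. (x, y')" and g = h])
    show "((\<lambda>y'. (x, y')) has_derivative (\<lambda>v. (0, v))) (at y)"
      by (auto intro!: derivative_eq_intros)
    show "(h has_derivative (\<lambda>w. w \<bullet> D)) (at (x, y))"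
      using assms by (simp add: gderiv_def)
  qed
  then show ?thesis unfolding gderiv_def by (simp add: inner_prod_def)
qed

text \<open>Strict differentiability: by the mean value inequality \<open>h - D\<close> has an
  arbitrarily small Lipschitz constant near \<open>a\<close>. Hence both end points may move and
  \<open>s\<close> may be unbounded, as long as the scaled differences converge.\<close>

lemma strict_derivative_limit:
  fixes h :: "'a::real_normed_vector \<Rightarrow> 'b::real_normed_vector"
  assumes "open U" "a \<in> U" "cont_diff_on U h" and D: "(h has_derivative D) (at a)"
    and p: "p \<longlonglongrightarrow> a" and q: "q \<longlonglongrightarrow> a"
    and d: "(\<lambda>k. s k *\<^sub>R (p k - q k)) \<longlonglongrightarrow> d"
  shows "(\<lambda>k. s k *\<^sub>R (h (p k) - h (q k))) \<longlonglongrightarrow> D d"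
proof -
  obtain D' :: "'a \<Rightarrow> 'a \<Rightarrow>\<^sub>L 'b"
    where D': "\<And>b. b \<in> U \<Longrightarrow> (h has_derivative D' b) (at b)" and cD: "continuous_on U D'"
    using assms(3) unfolding cont_diff_on_def by blast
  have Da: "D = blinfun_apply (D' a)"
    using D D'[OF \<open>a \<in> U\<close>] by (rule has_derivative_unique)
  have rem: "\<forall>\<^sub>F k in sequentially. norm (h (p k) - h (q k) - D (p k - q k)) \<le> e * norm (p k - q k)"
    if "e > 0" for e
  proof -
    have "isCont D' a"
      using cD assms(1,2) by (simp add: continuous_on_eq_continuous_at)
    then have "\<forall>\<^sub>F b in nhds a. dist (D' b) (D' a) < e"
      using \<open>e > 0\<close> by (simp add: continuous_at tendsto_at_iff_tendsto_nhds tendstoD)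
    moreover have "\<forall>\<^sub>F b in nhds a. b \<in> U"
      using assms(1,2) by (rule eventually_nhds_in_open)
    ultimately have "\<forall>\<^sub>F b in nhds a. dist (D' b) (D' a) < e \<and> b \<in> U"
      by (rule eventually_conj)
    then obtain r where "r > 0" and r: "\<And>b. dist b a < r \<Longrightarrow> dist (D' b) (D' a) < e \<and> b \<in> U"
      unfolding eventually_nhds_metric by blast
    have bound: "norm ((h u - D u) - (h v - D v)) \<le> e * norm (u - v)"
      if "u \<in> ball a r" "v \<in> ball a r" for u v
    proof (rule differentiable_bound[OF convex_ball _ _ that])
      fix b assume b: "b \<in> ball a r"
      then have b': "dist (D' b) (D' a) < e" "b \<in> U" using r[of b] by (auto simp: dist_commute)
      show "((\<lambda>u. h u - D u) has_derivative (\<lambda>v. (D' b - D' a) v)) (at b within ball a r)"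
        unfolding Da minus_blinfun.rep_eq
        by (intro has_derivative_diff has_derivative_at_withinI[OF D'[OF b'(2)]]
            bounded_linear_imp_has_derivative blinfun.bounded_linear_right)
      show "onorm (\<lambda>v. (D' b - D' a) v) \<le> e"
        using b'(1) by (simp add: dist_norm norm_blinfun.rep_eq)
    qed
    have "\<forall>\<^sub>F k in sequentially. p k \<in> ball a r \<and> q k \<in> ball a r"
      using p q \<open>r > 0\<close> by (intro eventually_conj topological_tendstoD) auto
    then show ?thesis
    proof eventually_elim
      case (elim k)
      then show ?case using bound[of "p k" "q k"]
        unfolding Da by (simp add: blinfun.bilinear_simps algebra_simps)
    qed
  qed
  interpret bounded_linear D using D by (rule has_derivative_bounded_linear)
  have "(\<lambda>k. s k *\<^sub>R (h (p k) - h (q k) - D (p k - q k))) \<longlonglongrightarrow> 0"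
  proof (rule tendstoI)
    fix e :: real assume "e > 0"
    \<comment> \<open>The scaled differences are eventually shorter than \<open>norm d + 1\<close>;
      the added 1 also keeps the denominator positive when \<open>d\<close> is zero.\<close>
    define e' where "e' = e / (norm d + 1)"
    have e': "e' > 0" "e' * (norm d + 1) = e"
      using \<open>e > 0\<close> by (auto simp: e'_def add_nonneg_pos divide_simps) (smt (verit) norm_ge_zero)
    have "(\<lambda>k. norm (s k *\<^sub>R (p k - q k))) \<longlonglongrightarrow> norm d" by (intro tendsto_norm d)
    then have "\<forall>\<^sub>F k in sequentially. norm (s k *\<^sub>R (p k - q k)) < norm d + 1"
      by (rule order_tendstoD) simp
    with rem[OF e'(1)]
    show "\<forall>\<^sub>F k in sequentially. dist (s k *\<^sub>R (h (p k) - h (q k) - D (p k - q k))) 0 < e"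
    proof eventually_elim
      case (elim k)
      have "norm (s k *\<^sub>R (h (p k) - h (q k) - D (p k - q k))) \<le> \<bar>s k\<bar> * (e' * norm (p k - q k))"
        using elim(1) by (auto intro: mult_left_mono)
      also have "\<dots> = e' * norm (s k *\<^sub>R (p k - q k))" by simp
      also have "\<dots> < e' * (norm d + 1)" using elim(2) e'(1) by (intro mult_strict_left_mono)
      finally show ?case using e'(2) by simp
    qed
  qed
  moreover have "(\<lambda>k. D (s k *\<^sub>R (p k - q k))) \<longlonglongrightarrow> D d"
    using d by (rule tendsto)
  ultimately have "(\<lambda>k. s k *\<^sub>R (h (p k) - h (q k) - D (p k - q k)) + D (s k *\<^sub>R (p k - q k))) \<longlonglongrightarrow> 0 + D d"
    by (rule tendsto_add)
  then show ?thesis by (simp add: scaleR flip: scaleR_right_distrib)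
qed

text \<open>The mean value theorem is applied in direction \<open>u\<close> only. It leaves a
  gradient difference over a step in direction \<open>v\<close>, which
  \<open>strict_derivative_limit\<close> evaluates. The bound on \<open>t\<close> keeps the
  parallelogram inside the ball.\<close>

lemma second_difference_limit:
  fixes h :: "'a::euclidean_space \<Rightarrow> real"
  assumes "ball a r \<subseteq> U" "r > 0" "open U" and h: "twice_cont_diff_on U h"
    and H: "(grad h has_derivative H) (at a)"
    and t: "\<And>k. t k > 0" "t \<longlonglongrightarrow> 0" "\<And>k. t k * (norm u + norm v) < r"
  shows "(\<lambda>k. (h (a + t k *\<^sub>R u + t k *\<^sub>R v) - h (a + t k *\<^sub>R u) - h (a + t k *\<^sub>R v) + h a) / (t k)\<^sup>2)
         \<longlonglongrightarrow> H v \<bullet> u"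
proof -
  have "a \<in> U" using assms(1,2) by auto
  have dh: "GDERIV h b :> grad h b" if "b \<in> U" for b
    using h that cont_diff_on_GDERIV unfolding twice_cont_diff_on_def by blast
  have inU: "a + s *\<^sub>R u + s' *\<^sub>R v \<in> U" if "0 \<le> s" "s \<le> t k" "0 \<le> s'" "s' \<le> t k" for s s' k
  proof -
    have "norm (s *\<^sub>R u + s' *\<^sub>R v) \<le> s * norm u + s' * norm v"
      using that by (intro order_trans[OF norm_triangle_ineq]) auto
    also have "\<dots> \<le> t k * (norm u + norm v)"
      using that by (simp add: distrib_left add_mono mult_right_mono)
    finally have "dist a (a + (s *\<^sub>R u + s' *\<^sub>R v)) < r" using t(3)[of k]
      by (simp only: dist_norm norm_minus_commute[of a]) simp
    then show ?thesis using assms(1) by (auto simp: add.assoc)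
  qed
  have "\<exists>s. 0 < s \<and> s < t k \<and>
      h (a + t k *\<^sub>R u + t k *\<^sub>R v) - h (a + t k *\<^sub>R u) - h (a + t k *\<^sub>R v) + h a
      = t k * ((grad h (a + s *\<^sub>R u + t k *\<^sub>R v) - grad h (a + s *\<^sub>R u)) \<bullet> u)" for k
  proof -
    define \<phi> where "\<phi> s = h (a + s *\<^sub>R u + t k *\<^sub>R v) - h (a + s *\<^sub>R u)" for s
    have "DERIV \<phi> s :> (grad h (a + s *\<^sub>R u + t k *\<^sub>R v) - grad h (a + s *\<^sub>R u)) \<bullet> u"
      if s: "0 \<le> s" "s \<le> t k" for s
    proof -
      have "(h has_derivative (\<lambda>w. w \<bullet> grad h (a + s *\<^sub>R u + t k *\<^sub>R v))) (at (a + s *\<^sub>R u + t k *\<^sub>R v))"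
        using dh[OF inU[of s k "t k"]] s t(1)[of k] by (simp add: gderiv_def)
      then have 1: "((\<lambda>s. h (a + s *\<^sub>R u + t k *\<^sub>R v)) has_derivative
          (\<lambda>x. (x *\<^sub>R u) \<bullet> grad h (a + s *\<^sub>R u + t k *\<^sub>R v))) (at s)"
        by (rule has_derivative_compose[rotated]) (auto intro!: derivative_eq_intros)
      have "(h has_derivative (\<lambda>w. w \<bullet> grad h (a + s *\<^sub>R u))) (at (a + s *\<^sub>R u))"
        using dh[OF inU[of s k 0]] s t(1)[of k] by (simp add: gderiv_def)
      then have 2: "((\<lambda>s. h (a + s *\<^sub>R u)) has_derivative
          (\<lambda>x. (x *\<^sub>R u) \<bullet> grad h (a + s *\<^sub>R u))) (at s)"
        by (rule has_derivative_compose[rotated]) (auto intro!: derivative_eq_intros)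
      show ?thesis unfolding \<phi>_def has_field_derivative_def
        by (rule has_derivative_eq_rhs[OF has_derivative_diff[OF 1 2]])
           (auto simp: algebra_simps inner_commute)
    qed
    from MVT2[OF t(1)[of k], of \<phi>, OF this] obtain s where
      "0 < s" "s < t k" "\<phi> (t k) - \<phi> 0 =
       t k * ((grad h (a + s *\<^sub>R u + t k *\<^sub>R v) - grad h (a + s *\<^sub>R u)) \<bullet> u)"
      by auto
    then show ?thesis unfolding \<phi>_def by (auto simp: algebra_simps)
  qed
  then obtain s where s: "\<And>k. 0 < s k" "\<And>k. s k < t k" and
    eq: "\<And>k. h (a + t k *\<^sub>R u + t k *\<^sub>R v) - h (a + t k *\<^sub>R u) - h (a + t k *\<^sub>R v) + h a
      = t k * ((grad h (a + s k *\<^sub>R u + t k *\<^sub>R v) - grad h (a + s k *\<^sub>R u)) \<bullet> u)"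
    by metis
  have s0: "s \<longlonglongrightarrow> 0"
    by (rule tendsto_sandwich[OF _ _ tendsto_const t(2)]) (auto intro!: always_eventually less_imp_le s)
  \<comment> \<open>Scaling by \<open>1 / t k\<close> makes the difference of the two base points
    constantly \<open>v\<close>, although \<open>s k\<close> is unknown.\<close>
  have "(\<lambda>k. (1 / t k) *\<^sub>R (grad h (a + s k *\<^sub>R u + t k *\<^sub>R v) - grad h (a + s k *\<^sub>R u))) \<longlonglongrightarrow> H v"
  proof (rule strict_derivative_limit[OF \<open>open U\<close> \<open>a \<in> U\<close> _ H])
    show "cont_diff_on U (grad h)" using h by (simp add: twice_cont_diff_on_def)
    have "(\<lambda>k. a + s k *\<^sub>R u + t k *\<^sub>R v) \<longlonglongrightarrow> a + 0 *\<^sub>R u + 0 *\<^sub>R v"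
      by (intro tendsto_intros s0 t)
    then show "(\<lambda>k. a + s k *\<^sub>R u + t k *\<^sub>R v) \<longlonglongrightarrow> a" by simp
    have "(\<lambda>k. a + s k *\<^sub>R u) \<longlonglongrightarrow> a + 0 *\<^sub>R u"
      by (intro tendsto_intros s0 t)
    then show "(\<lambda>k. a + s k *\<^sub>R u) \<longlonglongrightarrow> a" by simp
    have "(1 / t k) *\<^sub>R (a + s k *\<^sub>R u + t k *\<^sub>R v - (a + s k *\<^sub>R u)) = v" for k
      using t(1)[of k] by simp
    then show "(\<lambda>k. (1 / t k) *\<^sub>R (a + s k *\<^sub>R u + t k *\<^sub>R v - (a + s k *\<^sub>R u))) \<longlonglongrightarrow> v" by simp
  qed
  then have "(\<lambda>k. ((1 / t k) *\<^sub>R (grad h (a + s k *\<^sub>R u + t k *\<^sub>R v) - grad h (a + s k *\<^sub>R u))) \<bullet> u)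
      \<longlonglongrightarrow> H v \<bullet> u"
    by (intro tendsto_intros)
  moreover have "((1 / t k) *\<^sub>R (grad h (a + s k *\<^sub>R u + t k *\<^sub>R v) - grad h (a + s k *\<^sub>R u))) \<bullet> u
    = (h (a + t k *\<^sub>R u + t k *\<^sub>R v) - h (a + t k *\<^sub>R u) - h (a + t k *\<^sub>R v) + h a) / (t k)\<^sup>2" for k
    unfolding eq using t(1)[of k] by (simp add: power2_eq_square)
  ultimately show ?thesis by simp
qed

text \<open>Clairaut's theorem: the second difference is symmetric in \<open>u\<close> and
  \<open>v\<close>, and its limit can be computed with either of them as the direction of the mean
  value theorem.\<close>

lemma grad_derivative_symmetric:
  fixes h :: "'a::euclidean_space \<Rightarrow> real"
  assumes "open U" "a \<in> U" "twice_cont_diff_on U h" "(grad h has_derivative H) (at a)"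
  shows "H u \<bullet> v = H v \<bullet> u"
proof -
  obtain r where r: "r > 0" "ball a r \<subseteq> U" using assms(1,2) open_contains_ball by blast
  \<comment> \<open>The 1 in the denominator makes \<open>c * (norm u + norm v) < r\<close> strict
    and covers the case that both vectors are zero.\<close>
  define c where "c = r / (norm u + norm v + 1)"
  define t where "t k = c / (2 + real k)" for k
  have c: "c > 0" "c * (norm u + norm v) < r"
    using r(1) by (auto simp: c_def divide_simps add_nonneg_pos mult_strict_left_mono)
  have t: "t k > 0" "t k * (norm u + norm v) < r" for k
  proof -
    show "t k > 0" using c by (simp add: t_def)
    have "t k \<le> c" using c by (simp add: t_def divide_simps)
    then have "t k * (norm u + norm v) \<le> c * (norm u + norm v)" by (intro mult_right_mono) auto
    with c show "t k * (norm u + norm v) < r" by simp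
  qed
  have t0: "t \<longlonglongrightarrow> 0" unfolding t_def by (rule real_tendsto_divide_at_top[OF tendsto_const]) (intro filterlim_tendsto_add_at_top[OF tendsto_const] filterlim_real_sequentially)
  let ?d = "\<lambda>u v k. (h (a + t k *\<^sub>R u + t k *\<^sub>R v) - h (a + t k *\<^sub>R u) - h (a + t k *\<^sub>R v) + h a) / (t k)\<^sup>2"
  have "?d u v \<longlonglongrightarrow> H v \<bullet> u"
    by (rule second_difference_limit[OF r(2,1) assms(1,3,4)]) (use t t0 in auto)
  moreover have "?d v u \<longlonglongrightarrow> H u \<bullet> v"
    by (rule second_difference_limit[OF r(2,1) assms(1,3,4)]) (use t t0 in \<open>auto simp: add.commute\<close>)
  moreover have "?d u v = ?d v u" by (simp add: algebra_simps)
  ultimately have "?d u v \<longlonglongrightarrow> H v \<bullet> u" "?d u v \<longlonglongrightarrow> H u \<bullet> v" by simp_all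
  then show ?thesis by (rule LIMSEQ_unique[rotated])
qed

section \<open>The regularized lower-level problem\<close>

text \<open>A convex function decreases at most linearly away from \<open>y\<close>, so the
  quadratic term dominates outside a large ball, and a minimizer on that compact ball is
  global.\<close>

lemma convex_prox_minimizer_exists:
  fixes c :: "'a::euclidean_space \<Rightarrow> real"
  assumes "convex_on UNIV c" "\<gamma> > 0"
  shows "\<exists>\<theta>. \<forall>\<theta>'. c \<theta> + 1 / (2 * \<gamma>) * (norm (\<theta> - y))\<^sup>2 \<le> c \<theta>' + 1 / (2 * \<gamma>) * (norm (\<theta>' - y))\<^sup>2"
proof -
  let ?\<psi> = "\<lambda>\<theta>. c \<theta> + 1 / (2 * \<gamma>) * (norm (\<theta> - y))\<^sup>2"
  have cont: "continuous_on UNIV c" using assms(1) by (intro convex_on_continuous) auto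
  have "\<exists>m\<in>cball y 1. \<forall>v\<in>cball y 1. c m \<le> c v"
    by (intro continuous_attains_inf continuous_on_subset[OF cont]) auto
  then obtain m where m: "\<And>v. v \<in> cball y 1 \<Longrightarrow> c m \<le> c v" by blast
  define K where "K = c y - c m"
  have K: "K \<ge> 0" using m[of y] by (simp add: K_def)
  \<comment> \<open>Outside radius 1 the segment from \<open>y\<close> crosses the unit sphere;
    beyond \<open>2 * \<gamma> * K\<close> the quadratic term exceeds the possible decrease
    \<open>r * K\<close>.\<close>
  define R where "R = max 1 (2 * \<gamma> * K)"
  have "continuous_on (cball y R) ?\<psi>"
    by (intro continuous_intros continuous_on_subset[OF cont]) auto
  then obtain \<theta> where \<theta>: "\<theta> \<in> cball y R" "\<And>v. v \<in> cball y R \<Longrightarrow> ?\<psi> \<theta> \<le> ?\<psi> v"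
    using continuous_attains_inf[of "cball y R" ?\<psi>] by (force simp: R_def)
  have "?\<psi> \<theta> \<le> ?\<psi> v" if v: "v \<notin> cball y R" for v
  proof -
    define r where "r = norm (v - y)"
    have r: "r > 1" "r > 2 * \<gamma> * K" using v by (auto simp: R_def r_def dist_norm norm_minus_commute)
    \<comment> \<open>The point of the segment at distance 1 from \<open>y\<close> links
      \<open>c v\<close> to the lower bound \<open>c m\<close> on the unit ball.\<close>
    have "c ((1 - 1/r) *\<^sub>R y + (1/r) *\<^sub>R v) \<le> (1 - 1/r) * c y + (1/r) * c v"
      using assms(1) r(1) by (intro convex_onD) auto
    moreover have "(1 - 1/r) *\<^sub>R y + (1/r) *\<^sub>R v = y + (1/r) *\<^sub>R (v - y)"
      by (simp add: algebra_simps)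
    moreover have "c m \<le> c (y + (1/r) *\<^sub>R (v - y))"
      using r(1) by (intro m) (simp add: dist_norm r_def)
    ultimately have "c m \<le> (1 - 1/r) * c y + (1/r) * c v" by simp
    then have "r * c m \<le> r * ((1 - 1/r) * c y + (1/r) * c v)" using r(1) by simp
    also have "\<dots> = (r - 1) * c y + c v" using r(1) by (simp add: field_simps)
    finally have "c v \<ge> c y - r * K" by (simp add: K_def algebra_simps)
    moreover have "r * (2 * \<gamma> * K) \<le> r * r" using r by (intro mult_left_mono) auto
    then have "r * K \<le> 1 / (2 * \<gamma>) * r\<^sup>2"
      using assms(2) by (simp add: field_simps power2_eq_square)
    ultimately have "c y \<le> ?\<psi> v" by (simp add: r_def)
    moreover have "?\<psi> \<theta> \<le> ?\<psi> y" by (intro \<theta>(2)) (simp add: R_def)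
    ultimately show ?thesis by simp
  qed
  with \<theta>(2) show ?thesis by blast
qed

text \<open>The constant \<open>1 / (4 * \<gamma>)\<close> comes from comparing the minimizer with the midpoint of
  \<open>\<theta>\<close> and \<open>y\<close>; it is not the best possible one.\<close>

lemma convex_prox_minimizer_gap:
  fixes c :: "'a::real_inner \<Rightarrow> real"
  assumes "convex_on UNIV c" "\<gamma> > 0"
    and min: "\<And>\<theta>'. c \<theta> + 1 / (2 * \<gamma>) * (norm (\<theta> - y))\<^sup>2 \<le> c \<theta>' + 1 / (2 * \<gamma>) * (norm (\<theta>' - y))\<^sup>2"
  shows "c y - c \<theta> - 1 / (2 * \<gamma>) * (norm (\<theta> - y))\<^sup>2 \<ge> 1 / (4 * \<gamma>) * (norm (\<theta> - y))\<^sup>2"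
proof -
  define N where "N = 1 / (4 * \<gamma>) * (norm (\<theta> - y))\<^sup>2"
  let ?m = "(1 - 1/2) *\<^sub>R \<theta> + (1/2) *\<^sub>R y"
  have "c ?m \<le> (1 - 1/2) * c \<theta> + (1/2) * c y"
    using assms(1) by (intro convex_onD) auto
  moreover have "?m - y = (1/2) *\<^sub>R (\<theta> - y)"
    by (simp add: algebra_simps) (metis scaleR_half_double scaleR_right_distrib)
  then have half: "norm (?m - y) = norm (\<theta> - y) / 2" by (simp only: norm_scaleR)
  have "1 / (2 * \<gamma>) * (norm (?m - y))\<^sup>2 = N / 2"
    unfolding half N_def by (simp add: power_divide)
  moreover have "1 / (2 * \<gamma>) * (norm (\<theta> - y))\<^sup>2 = 2 * N" by (simp add: N_def)
  ultimately show ?thesis using min[of ?m] unfolding N_def[symmetric] by (simp add: algebra_simps)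
qed

text \<open>Fermat's rule; the vanishing functional is evaluated at its own representing vector to
  conclude that this vector is zero.\<close>

lemma prox_minimizer_gradient:
  fixes c :: "'a::real_inner \<Rightarrow> real"
  assumes "GDERIV c \<theta> :> D" "\<gamma> > 0"
    and min: "\<And>\<theta>'. c \<theta> + 1 / (2 * \<gamma>) * (norm (\<theta> - y))\<^sup>2 \<le> c \<theta>' + 1 / (2 * \<gamma>) * (norm (\<theta>' - y))\<^sup>2"
  shows "(1 / \<gamma>) *\<^sub>R (y - \<theta>) = D"
proof -
  have "((\<lambda>\<theta>. c \<theta> + 1 / (2 * \<gamma>) * (norm (\<theta> - y))\<^sup>2) has_derivative
      (\<lambda>v. v \<bullet> D + 1 / (2 * \<gamma>) * (2 * ((\<theta> - y) \<bullet> v)))) (at \<theta>)"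
    using assms(1,2) unfolding gderiv_def power2_norm_eq_inner
    by (auto intro!: derivative_eq_intros simp: inner_commute)
  also have "(\<lambda>v. v \<bullet> D + 1 / (2 * \<gamma>) * (2 * ((\<theta> - y) \<bullet> v)))
      = (\<lambda>v. v \<bullet> (D + (1 / \<gamma>) *\<^sub>R (\<theta> - y)))"
    by (simp add: inner_add_right inner_commute)
  finally have "(\<lambda>v. v \<bullet> (D + (1 / \<gamma>) *\<^sub>R (\<theta> - y))) = (\<lambda>v. 0)"
    by (rule has_derivative_local_min) (use min in simp)
  from fun_cong[OF this, of "D + (1 / \<gamma>) *\<^sub>R (\<theta> - y)"]
  have "(D + (1 / \<gamma>) *\<^sub>R (\<theta> - y)) \<bullet> (D + (1 / \<gamma>) *\<^sub>R (\<theta> - y)) = 0" .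
  then have "D = - ((1 / \<gamma>) *\<^sub>R (\<theta> - y))"
    by (simp only: inner_eq_zero_iff eq_neg_iff_add_eq_0)
  then show ?thesis by (simp add: algebra_simps)
qed

text \<open>Clipping at zero is closest in every coordinate separately, and a componentwise
  comparison of distances carries over to the norm.\<close>

lemma closest_point_nonneg_orthant:
  fixes a :: "real^'q"
  shows "closest_point {0..} a = (\<chi> i. max 0 (a $ i))"
proof (rule closest_point_unique[symmetric])
  show "convex {0::real^'q..}" by (auto simp: convex_def less_eq_vec_def)
  have "{0::real^'q..} = (\<Inter>i. {v. 0 \<le> v $ i})" by (auto simp: less_eq_vec_def)
  then show "closed {0::real^'q..}"
    by (simp add: closed_INT closed_Collect_le continuous_on_component)
  show "(\<chi> i. max 0 (a $ i)) \<in> {0..}" by (auto simp: less_eq_vec_def)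
  show "\<forall>v\<in>{0..}. dist a (\<chi> i. max 0 (a $ i)) \<le> dist a v"
  proof
    fix v :: "real^'q" assume "v \<in> {0..}"
    then have "\<bar>a $ i - max 0 (a $ i)\<bar> \<le> \<bar>a $ i - v $ i\<bar>" for i
      by (auto simp: less_eq_vec_def max_def dest: spec[of _ i])
    then show "dist a (\<chi> i. max 0 (a $ i)) \<le> dist a v"
      by (auto simp: dist_norm intro!: norm_le_componentwise_cart)
  qed
qed

lemma lambda_star_nth: "lambda_star g \<gamma>2 x y z $ i = max 0 (z $ i + \<gamma>2 * g (x, y) $ i)"
  by (simp add: lambda_star_def closest_point_nonneg_orthant)

text \<open>The projection inequality, tested at the point \<open>z\<close> of the orthant. In a
  coordinate without clipping it is an equality; where the projection clips to zero,
  \<open>g\<close> lies below \<open>- z / \<gamma>2\<close>.\<close>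

lemma lambda_star_gap:
  fixes g :: "(real^'n) \<times> (real^'m) \<Rightarrow> real^'q" and x y z
  assumes "0 \<le> z" "\<gamma>2 > 0"
  defines "l \<equiv> lambda_star g \<gamma>2 x y z"
  shows "(l - z) \<bullet> g (x, y) \<ge> 1 / \<gamma>2 * (norm (l - z))\<^sup>2"
proof -
  have "1 / \<gamma>2 * ((l $ i - z $ i) * (l $ i - z $ i)) \<le> (l $ i - z $ i) * g (x, y) $ i" for i
  proof (cases "z $ i + \<gamma>2 * g (x, y) $ i \<ge> 0")
    case True
    then show ?thesis using assms(2) by (simp add: l_def lambda_star_nth field_simps)
  next
    case False
    then have "z $ i / \<gamma>2 \<le> - g (x, y) $ i" using assms(2) by (simp add: field_simps)
    moreover have "0 \<le> z $ i" using assms(1) by (simp add: less_eq_vec_def)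
    ultimately have "z $ i * (z $ i / \<gamma>2) \<le> z $ i * (- g (x, y) $ i)" by (rule mult_left_mono)
    then show ?thesis using False by (simp add: l_def lambda_star_nth)
  qed
  then show ?thesis
    unfolding power2_norm_eq_inner inner_vec_def sum_distrib_left
    by (intro sum_mono) simp
qed

text \<open>\<open>arg_min_on\<close> is a choice, so the minimizing property has to be drawn from
  the existence of some minimizer.\<close>

lemma theta_star_minimizes:
  fixes f :: "(real^'n) \<times> (real^'m) \<Rightarrow> real"
  assumes "convex_on UNIV (\<lambda>v. f (x, v) + z \<bullet> g (x, v))" "\<gamma>1 > 0"
  shows "f (x, theta_star f g \<gamma>1 x y z) + z \<bullet> g (x, theta_star f g \<gamma>1 x y z)
           + 1 / (2 * \<gamma>1) * (norm (theta_star f g \<gamma>1 x y z - y))\<^sup>2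
         \<le> f (x, \<theta>) + z \<bullet> g (x, \<theta>) + 1 / (2 * \<gamma>1) * (norm (\<theta> - y))\<^sup>2"
proof -
  obtain \<theta>0 where *: "\<And>\<theta>. f (x, \<theta>0) + z \<bullet> g (x, \<theta>0) + 1 / (2 * \<gamma>1) * (norm (\<theta>0 - y))\<^sup>2
      \<le> f (x, \<theta>) + z \<bullet> g (x, \<theta>) + 1 / (2 * \<gamma>1) * (norm (\<theta> - y))\<^sup>2"
    using convex_prox_minimizer_exists[OF assms, of y] by auto
  show ?thesis unfolding theta_star_def arg_min_on_def
    by (rule arg_minI[of _ \<theta>0]) (use * in \<open>auto simp: not_less\<close>)
qed

text \<open>The supremum is at least the objective at \<open>theta_star\<close> and
  \<open>lambda_star\<close>, which splits into a part in \<open>\<theta>\<close> and a part in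
  \<open>l\<close>. The constants come from \<open>convex_prox_minimizer_gap\<close> and from
  \<open>lambda_star_gap\<close> after subtracting the penalty.\<close>

lemma gap_lower_bound:
  fixes f :: "(real^'n) \<times> (real^'m) \<Rightarrow> real" and g :: "(real^'n) \<times> (real^'m) \<Rightarrow> real^'q"
  assumes conv: "convex_on UNIV (\<lambda>v. f (x, v) + z \<bullet> g (x, v))"
    and "\<gamma>1 > 0" "\<gamma>2 > 0" "0 \<le> z"
  shows "1 / (4 * \<gamma>1) * (norm (theta_star f g \<gamma>1 x y z - y))\<^sup>2
       + 1 / (2 * \<gamma>2) * (norm (lambda_star g \<gamma>2 x y z - z))\<^sup>2 \<le> gap f g \<gamma>1 \<gamma>2 (x, y, z)"
proof -
  let ?V = "\<lambda>(\<theta>, l). lagr f g x y l - 1 / (2 * \<gamma>2) * (norm (l - z))\<^sup>2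
       - lagr f g x \<theta> z - 1 / (2 * \<gamma>1) * (norm (\<theta> - y))\<^sup>2"
  let ?\<theta> = "theta_star f g \<gamma>1 x y z" and ?l = "lambda_star g \<gamma>2 x y z"
  \<comment> \<open>A real supremum is informative only over a set bounded above: completing the
    square bounds the part in \<open>l\<close>, and minimality of \<open>theta_star\<close> bounds
    the other.\<close>
  have upper: "?V (\<theta>, l) \<le> ?V (?\<theta>, z) + \<gamma>2 / 2 * (norm (g (x, y)))\<^sup>2" for \<theta> l
  proof -
    have "0 \<le> (norm ((l - z) - \<gamma>2 *\<^sub>R g (x, y)))\<^sup>2 / (2 * \<gamma>2)" using assms by simp
    also have "\<dots> = 1 / (2 * \<gamma>2) * (norm (l - z))\<^sup>2 - (l - z) \<bullet> g (x, y)
        + \<gamma>2 / 2 * (norm (g (x, y)))\<^sup>2"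
      using assms(3) unfolding power2_norm_eq_inner
      by (simp add: inner_diff_left inner_diff_right inner_commute divide_simps)
    finally have "l \<bullet> g (x, y) - 1 / (2 * \<gamma>2) * (norm (l - z))\<^sup>2
        \<le> z \<bullet> g (x, y) + \<gamma>2 / 2 * (norm (g (x, y)))\<^sup>2"
      by (simp add: inner_diff_left)
    then show ?thesis using theta_star_minimizes[OF conv \<open>\<gamma>1 > 0\<close>, of y \<theta>]
      by (simp add: lagr_def)
  qed
  have "0 \<le> ?l" by (simp add: less_eq_vec_def lambda_star_nth)
  then have "?V (?\<theta>, ?l) \<le> (SUP p \<in> UNIV \<times> {0..}. ?V p)"
    by (intro cSUP_upper bdd_aboveI2[where M = "?V (?\<theta>, z) + \<gamma>2 / 2 * (norm (g (x, y)))\<^sup>2"])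
       (use upper in auto)
  also have "\<dots> = gap f g \<gamma>1 \<gamma>2 (x, y, z)" by (simp add: gap_def)
  finally have "?V (?\<theta>, ?l) \<le> gap f g \<gamma>1 \<gamma>2 (x, y, z)" .
  moreover have "1 / (4 * \<gamma>1) * (norm (?\<theta> - y))\<^sup>2
      \<le> f (x, y) + z \<bullet> g (x, y) - (f (x, ?\<theta>) + z \<bullet> g (x, ?\<theta>)) - 1 / (2 * \<gamma>1) * (norm (?\<theta> - y))\<^sup>2"
    by (rule convex_prox_minimizer_gap[OF conv \<open>\<gamma>1 > 0\<close>]) (rule theta_star_minimizes[OF conv \<open>\<gamma>1 > 0\<close>])
  moreover have "1 / (2 * \<gamma>2) * (norm (?l - z))\<^sup>2
      \<le> ?l \<bullet> g (x, y) - z \<bullet> g (x, y) - 1 / (2 * \<gamma>2) * (norm (?l - z))\<^sup>2"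
    using lambda_star_gap[OF \<open>0 \<le> z\<close> \<open>\<gamma>2 > 0\<close>, of g x y] by (simp add: inner_diff_left)
  ultimately show ?thesis by (simp add: lagr_def)
qed

section \<open>Normal cones and constraint qualifications\<close>

text \<open>If zero lies in the convex hull, its convex coefficients are the dependence. Otherwise a
  hyperplane strictly separates zero from the compact hull, and its reversed normal is the descent
  direction.\<close>

lemma gordan_alternative:
  fixes a :: "'i \<Rightarrow> 'a::euclidean_space"
  assumes "finite I"
  obtains (descent) d where "\<And>i. i \<in> I \<Longrightarrow> a i \<bullet> d < 0"
  | (dependence) \<mu> where "\<And>i. i \<in> I \<Longrightarrow> 0 \<le> \<mu> i" "\<exists>i\<in>I. \<mu> i \<noteq> 0" "(\<Sum>i\<in>I. \<mu> i *\<^sub>R a i) = 0"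
proof (cases "0 \<in> convex hull (a ` I)")
  case True
  then obtain u where u: "\<And>x. x \<in> a ` I \<Longrightarrow> 0 \<le> u x" "sum u (a ` I) = 1" "(\<Sum>x\<in>a ` I. u x *\<^sub>R x) = 0"
    using assms by (auto simp: convex_hull_finite)
  \<comment> \<open>Hull coefficients belong to vectors, not to indices; \<open>J\<close> keeps one
    index per vector, so that equal vectors are not counted twice.\<close>
  obtain J where J: "J \<subseteq> I" "inj_on a J" "a ` I = a ` J"
    using subset_image_inj[of "a ` I" a I] by auto
  define \<mu> where "\<mu> i = (if i \<in> J then u (a i) else 0)" for i
  have IJ: "I \<inter> J = J" using J(1) by auto
  show ?thesis
  proof (rule dependence)
    show "0 \<le> \<mu> i" if "i \<in> I" for i using u(1)[of "a i"] that by (auto simp: \<mu>_def)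
    have "(\<Sum>i\<in>I. \<mu> i) = 1"
      using u(2) assms J by (simp add: \<mu>_def sum.If_cases IJ sum.reindex)
    then show "\<exists>i\<in>I. \<mu> i \<noteq> 0" by (metis sum.neutral zero_neq_one)
    have "(\<Sum>i\<in>I. \<mu> i *\<^sub>R a i) = (\<Sum>i\<in>I. if i \<in> J then u (a i) *\<^sub>R a i else 0)"
      by (rule sum.cong) (auto simp: \<mu>_def)
    also have "\<dots> = 0" using u(3) assms J by (simp add: sum.If_cases IJ sum.reindex)
    finally show "(\<Sum>i\<in>I. \<mu> i *\<^sub>R a i) = 0" .
  qed
next
  case False
  have "closed (convex hull (a ` I))"
    using assms by (intro compact_imp_closed finite_imp_compact_convex_hull) auto
  from separating_hyperplane_closed_0[OF convex_convex_hull this False]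
  obtain d b where d: "b > 0" "\<And>x. x \<in> convex hull (a ` I) \<Longrightarrow> d \<bullet> x > b" by blast
  show ?thesis
  proof (rule descent[of "- d"])
    fix i assume "i \<in> I"
    then have "d \<bullet> a i > b" by (intro d(2) hull_inc) auto
    then show "a i \<bullet> - d < 0" using d(1) by (simp add: inner_commute)
  qed
qed

lemma GDERIV_descent:
  fixes h :: "'a::real_inner \<Rightarrow> real"
  assumes "GDERIV h a :> D" "D \<bullet> d < 0"
  shows "\<forall>\<^sub>F t in at_right 0. h (a + t *\<^sub>R d) < h a"
proof -
  have "((\<lambda>t. h (a + t *\<^sub>R d)) has_derivative (\<lambda>t. (t *\<^sub>R d) \<bullet> D)) (at 0)"
  proof (rule has_derivative_compose[where f = "\<lambda>t. a + t *\<^sub>R d" and g = h])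
    show "((\<lambda>t. a + t *\<^sub>R d) has_derivative (\<lambda>t. t *\<^sub>R d)) (at 0)"
      by (auto intro!: derivative_eq_intros)
    show "(h has_derivative (\<lambda>v. v \<bullet> D)) (at (a + 0 *\<^sub>R d))"
      using assms(1) by (simp add: gderiv_def)
  qed
  then have "DERIV (\<lambda>t. h (a + t *\<^sub>R d)) 0 :> D \<bullet> d"
    by (simp add: has_field_derivative_def inner_commute mult_commute_abs)
  from DERIV_neg_dec_right[OF this assms(2)]
  show ?thesis by (force simp: eventually_at_right_field)
qed

text \<open>Along a segment in a convex set both sides of the Frechet inequality scale with the
  step, so the local estimate becomes global. Letting \<open>e\<close> tend to zero leaves a
  variational inequality, which is stable under limits.\<close>

lemma limiting_normal_cone_convex:
  assumes "convex D" "v \<in> limiting_normal_cone D a" "b \<in> D"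
  shows "v \<bullet> (b - a) \<le> 0"
proof -
  have frechet: "u \<bullet> (b - c) \<le> 0" if u: "u \<in> frechet_normal_cone D c" for u c
  proof (cases "b = c")
    case False
    have c: "c \<in> D" using u by (auto simp: frechet_normal_cone_def split: if_splits)
    have "u \<bullet> (b - c) \<le> e * norm (b - c)" if "e > 0" for e
    proof -
      have "\<forall>\<^sub>F w in at c within D. u \<bullet> (w - c) \<le> e * norm (w - c)"
        using u \<open>e > 0\<close> c by (simp add: frechet_normal_cone_def)
      then obtain d where "d > 0" and d: "\<And>w. w \<in> D \<Longrightarrow> w \<noteq> c \<Longrightarrow> dist w c < d \<Longrightarrow>
          u \<bullet> (w - c) \<le> e * norm (w - c)"
        unfolding eventually_at by blast
      \<comment> \<open>At most 1 to stay on the segment, and short enough to land within half of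
        the radius \<open>d\<close>.\<close>
      define t where "t = min 1 (d / (2 * norm (b - c)))"
      have t: "0 < t" "t \<le> 1" using \<open>d > 0\<close> False by (auto simp: t_def)
      have "t * norm (b - c) \<le> d / (2 * norm (b - c)) * norm (b - c)"
        by (intro mult_right_mono) (auto simp: t_def)
      also have "\<dots> < d" using \<open>d > 0\<close> False by simp
      finally have "dist (c + t *\<^sub>R (b - c)) c < d" using t by (simp add: dist_norm)
      moreover have "c + t *\<^sub>R (b - c) \<in> D"
        using convexD_alt[OF assms(1) c assms(3), of t] t by (simp add: algebra_simps)
      ultimately have "u \<bullet> (c + t *\<^sub>R (b - c) - c) \<le> e * norm (c + t *\<^sub>R (b - c) - c)"
        using t False by (intro d) auto
      then show ?thesis using t by simp
    qed
    then have "u \<bullet> (b - c) / norm (b - c) \<le> e" if "e > 0" for e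
      using False that by (simp add: divide_le_eq)
    then have "u \<bullet> (b - c) / norm (b - c) \<le> 0" by (meson dense not_le)
    then show ?thesis using False by (simp add: divide_le_eq)
  qed simp
  obtain c u where c: "\<And>k. u k \<in> frechet_normal_cone D (c k)" "c \<longlonglongrightarrow> a" "u \<longlonglongrightarrow> v"
    using assms(2) by (auto simp: limiting_normal_cone_def split: if_splits)
  have "(\<lambda>k. u k \<bullet> (b - c k)) \<longlonglongrightarrow> v \<bullet> (b - a)" by (intro tendsto_intros c)
  then show ?thesis by (rule LIMSEQ_le_const2) (use frechet c(1) in blast)
qed

text \<open>Gordan's alternative for \<open>- v\<close> and the active gradients. A common descent
  direction would lead to feasible points that contradict normality; in a dependence the coefficient
  of \<open>- v\<close> cannot vanish because of \<open>d\<close>, and dividing by it yields the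
  multiplier.\<close>

lemma normal_multipliers:
  fixes G :: "'a::euclidean_space \<Rightarrow> real^'p"
  assumes a: "G a \<le> 0" and diff: "\<And>i. GDERIV (\<lambda>w. G w $ i) a :> grad (\<lambda>w. G w $ i) a"
    and desc: "\<And>i. G a $ i = 0 \<Longrightarrow> grad (\<lambda>w. G w $ i) a \<bullet> d < 0"
    and normal: "\<And>b. G b \<le> 0 \<Longrightarrow> v \<bullet> (b - a) \<le> 0"
  shows "\<exists>\<mu>. 0 \<le> \<mu> \<and> (\<forall>i. \<mu> $ i * G a $ i = 0) \<and> v = jacT G a \<mu>"
proof -
  let ?D = "\<lambda>i. grad (\<lambda>w. G w $ i) a"
  \<comment> \<open>\<open>None\<close> indexes the vector \<open>- v\<close>, and
    \<open>Some i\<close> the gradient of an active constraint.\<close>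
  define A where "A = insert None (Some ` {i. G a $ i = 0})"
  define b where "b j = (case j of None \<Rightarrow> - v | Some i \<Rightarrow> ?D i)" for j
  have "finite A" by (simp add: A_def)
  then show ?thesis
  proof (cases rule: gordan_alternative[of A b])
    case (descent e)
    have vpos: "v \<bullet> e > 0" using descent[of None] by (simp add: A_def b_def)
    \<comment> \<open>For small positive steps active constraints decrease, and inactive ones stay
      negative by continuity.\<close>
    have "\<forall>\<^sub>F t in at_right 0. G (a + t *\<^sub>R e) $ i \<le> 0" for i
    proof (cases "G a $ i = 0")
      case True
      then have "?D i \<bullet> e < 0" using descent[of "Some i"] by (simp add: A_def b_def)
      from GDERIV_descent[OF diff this] True show ?thesis by (auto elim: eventually_mono)
    next
      case False
      then have "G a $ i < 0" using a by (simp add: less_eq_vec_def order_less_le)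
      moreover have "isCont (\<lambda>w. G w $ i) a"
        using diff[of i] unfolding gderiv_def by (rule has_derivative_continuous)
      then have "((\<lambda>t. G (a + t *\<^sub>R e) $ i) \<longlongrightarrow> G a $ i) (at_right 0)"
        by (rule isCont_tendsto_compose) (auto intro!: tendsto_eq_intros)
      ultimately have "\<forall>\<^sub>F t in at_right 0. G (a + t *\<^sub>R e) $ i < 0"
        by (rule order_tendstoD(2)[rotated])
      then show ?thesis by (rule eventually_mono) simp
    qed
    then have "\<forall>\<^sub>F t in at_right 0. \<forall>i. G (a + t *\<^sub>R e) $ i \<le> 0"
      by (simp add: eventually_all_finite)
    moreover have "\<forall>\<^sub>F t in at_right 0. t > (0::real)" by (rule eventually_at_right_less)
    ultimately have "\<forall>\<^sub>F t in at_right 0. (\<forall>i. G (a + t *\<^sub>R e) $ i \<le> 0) \<and> t > (0::real)"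
      by (rule eventually_conj)
    then obtain t :: real where t: "\<And>i. G (a + t *\<^sub>R e) $ i \<le> 0" "t > 0"
      using eventually_happens[of _ "at_right (0::real)"] by auto
    have "v \<bullet> (a + t *\<^sub>R e - a) \<le> 0" using t(1) by (intro normal) (simp add: less_eq_vec_def)
    then show ?thesis using t(2) vpos by (simp add: mult_le_0_iff)
  next
    case (dependence u)
    have u0: "u None \<ge> 0" and u: "\<And>i. G a $ i = 0 \<Longrightarrow> u (Some i) \<ge> 0"
      using dependence(1) by (auto simp: A_def)
    have "(\<Sum>j\<in>A. u j *\<^sub>R b j) = u None *\<^sub>R (- v) + (\<Sum>i | G a $ i = 0. u (Some i) *\<^sub>R ?D i)"
      unfolding A_def by (subst sum.insert) (auto simp: sum.reindex b_def)
    then have comb: "u None *\<^sub>R v = (\<Sum>i | G a $ i = 0. u (Some i) *\<^sub>R ?D i)"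
      using dependence(3) by simp
    \<comment> \<open>Otherwise a nontrivial nonnegative combination of active gradients would
      vanish, whereas its pairing with \<open>d\<close> is strictly negative.\<close>
    have "u None \<noteq> 0"
    proof
      assume 0: "u None = 0"
      then obtain i where i: "G a $ i = 0" "u (Some i) \<noteq> 0"
        using dependence(2) by (auto simp: A_def)
      have "0 = (\<Sum>i | G a $ i = 0. u (Some i) * (?D i \<bullet> d))"
        using arg_cong[OF comb, of "\<lambda>w. w \<bullet> d"] 0 by (simp add: inner_sum_left)
      moreover have "0 < (\<Sum>i | G a $ i = 0. - (u (Some i) * (?D i \<bullet> d)))"
      proof (rule sum_pos2)
        show "0 < - (u (Some i) * (?D i \<bullet> d))"
          using i u[OF i(1)] desc[OF i(1)] by (simp add: mult_pos_neg)
        show "0 \<le> - (u (Some j) * (?D j \<bullet> d))" if "j \<in> {i. G a $ i = 0}" for j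
          using that u[of j] desc[of j] by (simp add: mult_nonneg_nonpos)
      qed (use i in auto)
      ultimately show False by (simp add: sum_negf)
    qed
    define \<mu> where "\<mu> = (\<chi> i. if G a $ i = 0 then u (Some i) / u None else 0)"
    have "u None *\<^sub>R jacT G a \<mu> = (\<Sum>i\<in>UNIV. if G a $ i = 0 then u (Some i) *\<^sub>R ?D i else 0)"
      unfolding jacT_def scaleR_sum_right using \<open>u None \<noteq> 0\<close> by (intro sum.cong) (auto simp: \<mu>_def)
    also have "\<dots> = u None *\<^sub>R v" unfolding comb by (simp add: sum.If_cases)
    finally have "v = jacT G a \<mu>" using \<open>u None \<noteq> 0\<close> by simp
    moreover have "0 \<le> \<mu>" using u u0 by (auto simp: \<mu>_def less_eq_vec_def)
    ultimately show ?thesis by (intro exI[of _ \<mu>]) (simp add: \<mu>_def)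
  qed
qed

section \<open>Transposed Jacobians, MFCQ and the normalization of multipliers\<close>

lemma has_derivative_inner_grad:
  fixes h :: "'a::euclidean_space \<Rightarrow> real"
  assumes "(h has_derivative D) (at a)"
  shows "v \<bullet> grad h a = D v"
proof -
  have "GDERIV h a :> grad h a"
    using has_derivative_GDERIV[OF assms] grad_eqI by metis
  then have "D = (\<lambda>v. v \<bullet> grad h a)"
    using assms unfolding gderiv_def by (rule has_derivative_unique[rotated])
  then show ?thesis by simp
qed

lemma GDERIV_inner_jacT:
  assumes "\<And>i. GDERIV (\<lambda>w. g w $ i) a :> grad (\<lambda>w. g w $ i) a"
  shows "GDERIV (\<lambda>w. z \<bullet> g w) a :> jacT g a z"
  using assms unfolding gderiv_def inner_vec_def jacT_def inner_sum_right
  by (auto intro!: has_derivative_sum has_derivative_mult_right)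

lemma inner_jacT: "v \<bullet> jacT g a z = (\<Sum>i\<in>UNIV. z $ i * (v \<bullet> grad (\<lambda>w. g w $ i) a))"
  by (simp add: jacT_def inner_sum_right)

lemma jacT_diff: "jacT g a (u - v) = jacT g a u - jacT g a v"
  by (simp add: jacT_def scaleR_diff_left sum_subtractf)

lemma jacT_scaleR: "jacT g a (c *\<^sub>R u) = c *\<^sub>R jacT g a u"
  by (simp add: jacT_def scaleR_sum_right)

lemma jacT_zero [simp]: "jacT g a 0 = 0"
  by (simp add: jacT_def)

lemma tendsto_jacT:
  assumes "\<And>i. isCont (grad (\<lambda>w. g w $ i)) a" "(p \<longlongrightarrow> a) S" "(u \<longlongrightarrow> v) S"
  shows "((\<lambda>k. jacT g (p k) (u k)) \<longlongrightarrow> jacT g a v) S"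
  unfolding jacT_def using assms
  by (intro tendsto_sum tendsto_scaleR tendsto_vec_nth isCont_tendsto_compose[OF assms(1)]) auto

text \<open>Complementarity permits multiplier vectors over all indices: inactive entries vanish, so
  the sum over the active set equals \<open>jacT\<close>.\<close>

lemma mfcq_ineqD:
  assumes "mfcq_ineq c w" "0 \<le> \<mu>" "\<And>i. \<mu> $ i * c w $ i = 0" "jacT c w \<mu> = 0"
  shows "\<mu> = 0"
proof -
  have zero: "\<mu> $ i = 0" if "c w $ i \<noteq> 0" for i using assms(3)[of i] that by simp
  have s: "(\<Sum>i | c w $ i = 0. \<mu> $ i *\<^sub>R grad (\<lambda>w. c w $ i) w) = jacT c w \<mu>"
    unfolding jacT_def by (rule sum.mono_neutral_left) (use zero in auto)
  have "\<mu> $ i = 0" if "c w $ i = 0" for i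
  proof -
    have nn: "\<forall>i\<in>{i\<in>UNIV. c w $ i = 0}. 0 \<le> \<mu> $ i" using assms(2) by (simp add: less_eq_vec_def)
    have "(\<Sum>j\<in>({}::unit set). 0 *\<^sub>R grad ((\<lambda>_ _. 0) j) w) + (\<Sum>i\<in>{i\<in>UNIV. c w $ i = 0}. \<mu> $ i *\<^sub>R grad (\<lambda>w. c w $ i) w) = 0"
      using s assms(4) by simp
    with nn have "\<forall>i\<in>{i\<in>UNIV. c w $ i = 0}. \<mu> $ i = 0"
      using assms(1)[unfolded mfcq_ineq_def mfcq_def, THEN conjunct2, THEN conjunct2,
        THEN spec[of _ "\<lambda>_. 0"], THEN spec[of _ "\<lambda>i. \<mu> $ i"]] by blast
    then show ?thesis using that by simp
  qed
  then have "\<mu> $ i = 0" for i using zero by (cases "c w $ i = 0") auto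
  then show ?thesis by (simp add: vec_eq_iff)
qed

text \<open>Gordan's alternative passes from the multiplier form of MFCQ to its primal form, a
  strict descent direction, which persists at nearby points.\<close>

lemma mfcq_ineq_descent:
  fixes c :: "'w::euclidean_space \<Rightarrow> real^'k"
  assumes "mfcq_ineq c w"
  obtains d where "\<And>i. c w $ i = 0 \<Longrightarrow> grad (\<lambda>w. c w $ i) w \<bullet> d < 0"
proof -
  have "finite {i. c w $ i = 0}" by simp
  then show ?thesis
  proof (cases rule: gordan_alternative[of "{i. c w $ i = 0}" "\<lambda>i. grad (\<lambda>w. c w $ i) w"])
    case (dependence \<mu>)
    define m where "m = (\<chi> i. if c w $ i = 0 then \<mu> i else 0)"
    have "jacT c w m = (\<Sum>i | c w $ i = 0. \<mu> i *\<^sub>R grad (\<lambda>w. c w $ i) w)"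
      unfolding jacT_def by (rule sum.mono_neutral_cong_right) (auto simp: m_def)
    then have "m = 0" using dependence
      by (intro mfcq_ineqD[OF assms]) (auto simp: m_def less_eq_vec_def)
    moreover have "\<mu> i = m $ i" if "c w $ i = 0" for i using that by (simp add: m_def)
    ultimately have "\<mu> i = 0" if "c w $ i = 0" for i using that by simp
    with dependence(2) show ?thesis by auto
  qed (use that in auto)
qed

lemma mfcq_ineq_imp_le: "mfcq_ineq c w \<Longrightarrow> c w \<le> 0"
  by (simp add: mfcq_ineq_def mfcq_def less_eq_vec_def)

lemma convex_on_inner_nonneg:
  fixes h :: "'a::real_vector \<Rightarrow> real^'q"
  assumes "0 \<le> v" "\<And>i. convex_on S (\<lambda>a. h a $ i)"
  shows "convex_on S (\<lambda>a. v \<bullet> h a)"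
proof (rule convex_onI)
  show "convex S" using assms(2) by (rule convex_on_imp_convex)
  fix t :: real and a b assume t: "0 < t" "t < 1" and ab: "a \<in> S" "b \<in> S"
  have "v $ i * h ((1 - t) *\<^sub>R a + t *\<^sub>R b) $ i \<le> v $ i * ((1 - t) * h a $ i + t * h b $ i)" for i
    using assms(1) convex_onD[OF assms(2), of t a b i] t ab
    by (intro mult_left_mono) (auto simp: less_eq_vec_def)
  then have "v \<bullet> h ((1 - t) *\<^sub>R a + t *\<^sub>R b) \<le> (\<Sum>i\<in>UNIV. v $ i * ((1 - t) * h a $ i + t * h b $ i))"
    unfolding inner_vec_def by (intro sum_mono) simp
  also have "\<dots> = (1 - t) * (v \<bullet> h a) + t * (v \<bullet> h b)"
    unfolding inner_vec_def by (simp add: sum_distrib_left distrib_left sum.distrib mult_ac)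
  finally show "v \<bullet> h ((1 - t) *\<^sub>R a + t *\<^sub>R b) \<le> (1 - t) * (v \<bullet> h a) + t * (v \<bullet> h b)" .
qed

text \<open>Each component may be convex on its own set; the convexity inequality is applied only
  with both end points in \<open>Omega G\<close>, which lies in all of these sets.\<close>

lemma convex_OmegaI:
  assumes "\<And>i. Omega G \<subseteq> U i" "\<And>i. convex_on (U i) (\<lambda>w. G w $ i)"
  shows "convex (Omega G)"
proof (rule convexI)
  fix a b s t assume ab: "a \<in> Omega G" "b \<in> Omega G" and st: "0 \<le> s" "0 \<le> t" "s + t = (1::real)"
  have "G (s *\<^sub>R a + t *\<^sub>R b) $ i \<le> 0" for i
  proof -
    have "G (s *\<^sub>R a + t *\<^sub>R b) $ i \<le> s * G a $ i + t * G b $ i"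
      using assms(2)[of i] assms(1)[of i] ab st unfolding convex_on_def by blast
    also have "\<dots> \<le> 0"
      using ab st by (intro add_nonpos_nonpos mult_nonneg_nonpos) (auto simp: Omega_def less_eq_vec_def)
    finally show ?thesis .
  qed
  then show "s *\<^sub>R a + t *\<^sub>R b \<in> Omega G" by (simp add: Omega_def less_eq_vec_def case_prod_unfold)
qed

text \<open>Dividing by \<open>max 1 (norm (T k))\<close> treats bounded and unbounded sequences
  alike. If the factors tend to zero, the limit vector has norm 1, which is what a constraint
  qualification will contradict.\<close>

lemma scaled_convergent_subsequence:
  fixes T :: "nat \<Rightarrow> 'a::euclidean_space"
  obtains r \<sigma> \<tau> t where "strict_mono r" "\<And>k. 0 \<le> \<sigma> k" "\<And>k. \<sigma> k \<le> 1" "\<sigma> \<longlonglongrightarrow> \<tau>"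
    "(\<lambda>k. \<sigma> k *\<^sub>R T (r k)) \<longlonglongrightarrow> t" "0 \<le> \<tau>" "\<tau> = 0 \<Longrightarrow> norm t = 1"
proof -
  define N where "N k = max 1 (norm (T k))" for k
  have N: "N k \<ge> 1" "norm (T k) \<le> N k" for k by (auto simp: N_def)
  have "(1 / N k, (1 / N k) *\<^sub>R T k) \<in> cball 0 1 \<times> cball 0 1" for k
    using N[of k] by (simp add: divide_le_eq)
  then have "range (\<lambda>k. (1 / N k, (1 / N k) *\<^sub>R T k)) \<subseteq> cball 0 1 \<times> cball 0 1" by blast
  then have "bounded (range (\<lambda>k. (1 / N k, (1 / N k) *\<^sub>R T k)))"
    using bounded_Times[OF bounded_cball bounded_cball] bounded_subset by blast
  then obtain c r where r: "strict_mono r"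
    and c: "((\<lambda>k. (1 / N k, (1 / N k) *\<^sub>R T k)) \<circ> r) \<longlonglongrightarrow> c"
    using bounded_imp_convergent_subsequence by blast
  define \<sigma> where "\<sigma> k = 1 / N (r k)" for k
  have \<sigma>: "\<sigma> \<longlonglongrightarrow> fst c" and t: "(\<lambda>k. \<sigma> k *\<^sub>R T (r k)) \<longlonglongrightarrow> snd c"
    using tendsto_fst[OF c] tendsto_snd[OF c] by (simp_all add: o_def \<sigma>_def[abs_def])
  have \<sigma>01: "0 \<le> \<sigma> k" "\<sigma> k \<le> 1" for k using N(1)[of "r k"] by (auto simp: \<sigma>_def)
  have "norm (snd c) = 1" if "fst c = 0"
  proof (rule LIMSEQ_unique[OF tendsto_norm[OF t]])
    \<comment> \<open>A factor below 1 means that the maximum is the norm itself.\<close>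
    have "\<forall>\<^sub>F k in sequentially. \<sigma> k < 1" using order_tendstoD(2)[OF \<sigma>, of 1] that by simp
    then have "\<forall>\<^sub>F k in sequentially. norm (\<sigma> k *\<^sub>R T (r k)) = 1"
      by eventually_elim (auto simp: \<sigma>_def N_def max_def split: if_splits)
    then show "(\<lambda>k. norm (\<sigma> k *\<^sub>R T (r k))) \<longlonglongrightarrow> 1" by (rule tendsto_eventually)
  qed
  moreover have "0 \<le> fst c" by (rule LIMSEQ_le_const[OF \<sigma>]) (use \<sigma>01 in auto)
  ultimately show ?thesis using that[OF r \<sigma>01 \<sigma> t] by blast
qed

section \<open>Limits of approximately stationary sequences\<close>

text \<open>The sequences are already restricted so that \<open>z\<close> converges.
  \<open>\<nu>\<close> collects the chosen normal vectors; \<open>V\<close> and \<open>W\<close> are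
  neighbourhoods common to all components of the data.\<close>

locale gap_sequence =
  fixes F f :: "(real^'n) \<times> (real^'m) \<Rightarrow> real"
    and G :: "(real^'n) \<times> (real^'m) \<Rightarrow> real^'p"
    and g :: "(real^'n) \<times> (real^'m) \<Rightarrow> real^'q"
    and \<gamma>1 \<gamma>2 :: real
    and x :: "nat \<Rightarrow> real^'n" and y :: "nat \<Rightarrow> real^'m" and z :: "nat \<Rightarrow> real^'q"
    and \<epsilon> \<nu> :: "nat \<Rightarrow> (real^'n) \<times> (real^'m) \<times> (real^'q)"
    and \<rho> :: "nat \<Rightarrow> real"
    and xbar :: "real^'n" and ybar :: "real^'m" and zbar :: "real^'q"
    and V W :: "((real^'n) \<times> (real^'m)) set"
  assumes V: "open V" "Omega G \<subseteq> V" "cont_diff_on V F" "\<And>i. cont_diff_on V (\<lambda>w. G w $ i)"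
    and W: "open W" "X_set G \<times> UNIV \<subseteq> W" "twice_cont_diff_on W f"
      "\<And>i. twice_cont_diff_on W (\<lambda>w. g w $ i)"
    and convex_Omega: "convex (Omega G)"
    and convex_lower: "\<And>u v. u \<in> X_set G \<Longrightarrow> 0 \<le> v \<Longrightarrow> convex_on UNIV (\<lambda>y. f (u, y) + v \<bullet> g (u, y))"
    and gamma_pos: "\<gamma>1 > 0" "\<gamma>2 > 0"
    and rho_pos: "\<And>k. \<rho> k > 0"
    and lim: "x \<longlonglongrightarrow> xbar" "y \<longlonglongrightarrow> ybar" "z \<longlonglongrightarrow> zbar" "\<epsilon> \<longlonglongrightarrow> 0"
    and in_Omega_plus: "\<And>k. (x k, y k, z k) \<in> Omega_plus G"
    and gap_lim: "(\<lambda>k. gap f g \<gamma>1 \<gamma>2 (x k, y k, z k)) \<longlonglongrightarrow> 0"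
    and normal: "\<And>k. \<nu> k \<in> limiting_normal_cone (Omega_plus G) (x k, y k, z k)"
    and approx_stationary:
      "\<And>k. \<epsilon> k = (fst (grad F (x k, y k)), snd (grad F (x k, y k)), 0)
               + \<rho> k *\<^sub>R gap_grad f g \<gamma>1 \<gamma>2 (x k, y k, z k) + \<nu> k"
    and mfcq_upper: "mfcq_ineq G (xbar, ybar)"
begin

section \<open>Limits of the inner solutions and feasibility of the limit point\<close>

definition "\<theta> k = theta_star f g \<gamma>1 (x k) (y k) (z k)"
definition "l k = lambda_star g \<gamma>2 (x k) (y k) (z k)"
text \<open>The gradient in both variables of the Lagrangian with multiplier \<open>v\<close> held
  fixed; \<open>hessL\<close> is its Hessian at the limit point for the multiplier
  \<open>zbar\<close>.\<close>

definition "gradL v a = grad f a + jacT g a v"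
definition "hessL v = frechet_derivative (grad f) (at (xbar, ybar)) v
  + (\<Sum>i\<in>UNIV. zbar $ i *\<^sub>R frechet_derivative (grad (\<lambda>w. g w $ i)) (at (xbar, ybar)) v)"

text \<open>The limits of \<open>\<omega>\<close> and \<open>\<eta>\<close>, suitably scaled, become the MPCC multipliers.\<close>

definition "\<omega> k = \<rho> k *\<^sub>R (y k - \<theta> k)"
definition "\<eta> k = \<rho> k *\<^sub>R (l k - z k)"

lemma z_nonneg: "0 \<le> z k" "0 \<le> z k $ i"
  using in_Omega_plus[of k] by (auto simp: Omega_plus_def less_eq_vec_def)

lemma zbar_nonneg: "0 \<le> zbar $ i"
proof (rule LIMSEQ_le_const)
  show "(\<lambda>k. z k $ i) \<longlonglongrightarrow> zbar $ i" by (intro tendsto_intros lim)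
qed (use z_nonneg in blast)

lemma in_Omega: "(x k, y k) \<in> Omega G" "G (x k, y k) \<le> 0"
  using in_Omega_plus[of k] by (auto simp: Omega_plus_def Omega_def)

lemma bar_in_Omega: "(xbar, ybar) \<in> Omega G" "G (xbar, ybar) \<le> 0"
  using mfcq_ineq_imp_le[OF mfcq_upper] by (auto simp: Omega_def)

lemma in_X: "x k \<in> X_set G" "xbar \<in> X_set G"
  using in_Omega bar_in_Omega by (auto simp: X_set_def)

lemma in_W: "(x k, v) \<in> W" "(xbar, v) \<in> W"
  using in_X W(2) by auto

lemma in_V: "(x k, y k) \<in> V" "(xbar, ybar) \<in> V"
  using in_Omega bar_in_Omega V(2) by auto

lemma cont_diff_W: "cont_diff_on W f" "cont_diff_on W (\<lambda>w. g w $ i)"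
    "cont_diff_on W (grad f)" "cont_diff_on W (grad (\<lambda>w. g w $ i))"
  using W(3,4) by (auto simp: twice_cont_diff_on_def)

lemma isCont_W:
  assumes "a \<in> W"
  shows "isCont (\<lambda>w. g w $ i) a" "isCont (grad f) a" "isCont (grad (\<lambda>w. g w $ i)) a"
  using cont_diff_W cont_diff_on_isCont assms by blast+

lemma GDERIV_W:
  assumes "a \<in> W"
  shows "GDERIV f a :> grad f a" "GDERIV (\<lambda>w. g w $ i) a :> grad (\<lambda>w. g w $ i) a"
  using cont_diff_W cont_diff_on_GDERIV assms by blast+

lemma GDERIV_lagrangian:
  "a \<in> W \<Longrightarrow> GDERIV (\<lambda>w. f w + v \<bullet> g w) a :> gradL v a"
  unfolding gradL_def by (intro GDERIV_add GDERIV_inner_jacT GDERIV_W)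

text \<open>Both squares in \<open>gap_lower_bound\<close> are nonnegative, so each one separately
  is squeezed to zero by the gap values.\<close>

lemma gap_parts_tendsto: "(\<lambda>k. y k - \<theta> k) \<longlonglongrightarrow> 0" "(\<lambda>k. l k - z k) \<longlonglongrightarrow> 0"
proof -
  have bound: "1 / (4 * \<gamma>1) * (norm (\<theta> k - y k))\<^sup>2 + 1 / (2 * \<gamma>2) * (norm (l k - z k))\<^sup>2
      \<le> gap f g \<gamma>1 \<gamma>2 (x k, y k, z k)" for k
    unfolding \<theta>_def l_def by (intro gap_lower_bound convex_lower in_X gamma_pos z_nonneg)
  have sq: "(\<lambda>k. v k) \<longlonglongrightarrow> 0"
    if "c > 0" "\<And>k. 1 / c * (norm (v k))\<^sup>2 \<le> gap f g \<gamma>1 \<gamma>2 (x k, y k, z k)"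
    for c :: real and v :: "nat \<Rightarrow> 'b::real_normed_vector"
  proof -
    have "(\<lambda>k. (norm (v k))\<^sup>2) \<longlonglongrightarrow> 0"
    proof (rule tendsto_sandwich[OF _ _ tendsto_const])
      show "\<forall>\<^sub>F k in sequentially. (norm (v k))\<^sup>2 \<le> c * gap f g \<gamma>1 \<gamma>2 (x k, y k, z k)"
        using that by (auto intro!: always_eventually simp: field_simps)
      show "(\<lambda>k. c * gap f g \<gamma>1 \<gamma>2 (x k, y k, z k)) \<longlonglongrightarrow> 0"
        using tendsto_mult_right_zero[OF gap_lim] .
    qed simp
    then have "(\<lambda>k. sqrt ((norm (v k))\<^sup>2)) \<longlonglongrightarrow> sqrt 0" by (intro tendsto_intros)
    then show ?thesis by (simp add: tendsto_norm_zero_iff)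
  qed
  have nn: "0 \<le> 1 / (4 * \<gamma>1) * (norm (\<theta> k - y k))\<^sup>2" "0 \<le> 1 / (2 * \<gamma>2) * (norm (l k - z k))\<^sup>2" for k
    using gamma_pos by simp_all
  show "(\<lambda>k. y k - \<theta> k) \<longlonglongrightarrow> 0"
  proof (rule sq)
    show "1 / (4 * \<gamma>1) * (norm (y k - \<theta> k))\<^sup>2 \<le> gap f g \<gamma>1 \<gamma>2 (x k, y k, z k)" for k
      using bound[of k] nn(2)[of k] by (simp add: norm_minus_commute)
  qed (use gamma_pos in simp)
  show "(\<lambda>k. l k - z k) \<longlonglongrightarrow> 0"
  proof (rule sq)
    show "1 / (2 * \<gamma>2) * (norm (l k - z k))\<^sup>2 \<le> gap f g \<gamma>1 \<gamma>2 (x k, y k, z k)" for k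
      using bound[of k] nn(1)[of k] by simp
  qed (use gamma_pos in simp)
qed

lemma theta_tendsto: "\<theta> \<longlonglongrightarrow> ybar"
  using tendsto_diff[OF lim(2) gap_parts_tendsto(1)] by simp

lemma l_tendsto: "l \<longlonglongrightarrow> zbar"
  using tendsto_add[OF gap_parts_tendsto(2) lim(3)] by simp

lemma pair_tendsto:
  "(\<lambda>k. (x k, y k)) \<longlonglongrightarrow> (xbar, ybar)" "(\<lambda>k. (x k, \<theta> k)) \<longlonglongrightarrow> (xbar, ybar)"
  by (intro tendsto_Pair lim theta_tendsto)+

text \<open>Used twice: its limit is lower-level stationarity, and it replaces the proximal term in
  the gradient of the gap function.\<close>

lemma theta_stationary: "(1 / \<gamma>1) *\<^sub>R (y k - \<theta> k) = snd (gradL (z k) (x k, \<theta> k))"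
proof (rule prox_minimizer_gradient)
  show "GDERIV (\<lambda>v. f (x k, v) + z k \<bullet> g (x k, v)) (\<theta> k) :> snd (gradL (z k) (x k, \<theta> k))"
    using GDERIV_snd_section[OF GDERIV_lagrangian[OF in_W(1)]] .
  show "f (x k, \<theta> k) + z k \<bullet> g (x k, \<theta> k) + 1 / (2 * \<gamma>1) * (norm (\<theta> k - y k))\<^sup>2
      \<le> f (x k, v) + z k \<bullet> g (x k, v) + 1 / (2 * \<gamma>1) * (norm (v - y k))\<^sup>2" for v
    unfolding \<theta>_def by (intro theta_star_minimizes convex_lower in_X z_nonneg gamma_pos)
qed (rule gamma_pos)

lemma l_nth: "l k $ i = max 0 (z k $ i + \<gamma>2 * g (x k, y k) $ i)"
  by (simp add: l_def lambda_star_nth)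

lemma tendsto_gradL:
  "(p \<longlongrightarrow> (xbar, ybar)) S \<Longrightarrow> (u \<longlongrightarrow> v) S \<Longrightarrow> ((\<lambda>k. gradL (u k) (p k)) \<longlongrightarrow> gradL v (xbar, ybar)) S"
  unfolding gradL_def
  by (intro tendsto_add tendsto_jacT isCont_tendsto_compose[OF isCont_W(2)] isCont_W in_W)

lemma tendsto_g: "(p \<longlongrightarrow> (xbar, ybar)) S \<Longrightarrow> ((\<lambda>k. g (p k) $ i) \<longlongrightarrow> g (xbar, ybar) $ i) S"
  by (rule isCont_tendsto_compose[OF isCont_W(1)[OF in_W(2)]])

text \<open>Limits of the optimality condition of \<open>\<theta>\<close> and of the projection
  formula for \<open>l\<close>; the second one is complementarity in fixed-point form.\<close>

lemma feasible_limit: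
  "snd (gradL zbar (xbar, ybar)) = 0" "zbar $ i = max 0 (zbar $ i + \<gamma>2 * g (xbar, ybar) $ i)"
proof -
  have "(\<lambda>k. (1 / \<gamma>1) *\<^sub>R (y k - \<theta> k)) \<longlonglongrightarrow> snd (gradL zbar (xbar, ybar))"
    unfolding theta_stationary by (intro tendsto_snd tendsto_gradL pair_tendsto lim)
  moreover have "(\<lambda>k. (1 / \<gamma>1) *\<^sub>R (y k - \<theta> k)) \<longlonglongrightarrow> (1 / \<gamma>1) *\<^sub>R 0"
    by (intro tendsto_intros gap_parts_tendsto)
  ultimately show "snd (gradL zbar (xbar, ybar)) = 0"
    using LIMSEQ_unique by fastforce
  have "(\<lambda>k. l k $ i) \<longlonglongrightarrow> max 0 (zbar $ i + \<gamma>2 * g (xbar, ybar) $ i)"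
    unfolding l_nth by (intro tendsto_intros lim tendsto_g pair_tendsto)
  moreover have "(\<lambda>k. l k $ i) \<longlonglongrightarrow> zbar $ i" by (intro tendsto_intros l_tendsto)
  ultimately show "zbar $ i = max 0 (zbar $ i + \<gamma>2 * g (xbar, ybar) $ i)"
    using LIMSEQ_unique by blast
qed

text \<open>Either the maximum in the fixed-point equation is its second argument and
  \<open>g\<close> vanishes, or \<open>zbar\<close> is zero and \<open>g\<close> is
  negative.\<close>

lemma complementarity_limit:
  "g (xbar, ybar) $ i \<le> 0" "zbar $ i * g (xbar, ybar) $ i = 0"
  using feasible_limit(2)[of i] zbar_nonneg[of i] gamma_pos(2)
  by (auto simp: max_def zero_le_mult_iff split: if_splits)

lemma grad_lower_lagrangian:
  "(u, v) \<in> W \<Longrightarrow> grad (\<lambda>y'. lagr f g u y' c) v = snd (gradL c (u, v))"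
  unfolding lagr_def by (intro grad_eqI GDERIV_snd_section GDERIV_lagrangian)

lemma mpcc_feasible_limit: "mpcc_feasible f G g (xbar, ybar, zbar)"
proof -
  have "zbar \<bullet> - g (xbar, ybar) = 0"
    by (simp add: inner_vec_def complementarity_limit)
  then show ?thesis
    using bar_in_Omega zbar_nonneg complementarity_limit(1)
    by (simp add: mpcc_feasible_def grad_lower_lagrangian in_W feasible_limit(1) less_eq_vec_def)
qed

lemma index_partition:
  "i \<in> I_0p g (xbar, ybar, zbar) \<or> i \<in> I_p0 g (xbar, ybar, zbar) \<or> i \<in> I_00 g (xbar, ybar, zbar)"
  using complementarity_limit[of i] zbar_nonneg[of i]
  by (auto simp: I_0p_def I_p0_def I_00_def order_less_le)

section \<open>Normal vectors to the product set and multipliers of the upper-level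
  constraints\<close>

lemma normal_inequality:
  assumes "b \<in> Omega G" "0 \<le> c"
  shows "fst (\<nu> k) \<bullet> (fst b - x k) + fst (snd (\<nu> k)) \<bullet> (snd b - y k) + snd (snd (\<nu> k)) \<bullet> (c - z k) \<le> 0"
proof -
  \<comment> \<open>Convexity of the product set turns limiting normals into solutions of a
    variational inequality.\<close>
  have "convex (Omega_plus G :: ((real^'n) \<times> (real^'m) \<times> (real^'q)) set)"
  proof (rule convexI)
    fix a b :: "(real^'n) \<times> (real^'m) \<times> (real^'q)" and s t :: real
    assume *: "a \<in> Omega_plus G" "b \<in> Omega_plus G" "0 \<le> s" "0 \<le> t" "s + t = 1"
    have "s *\<^sub>R (fst a, fst (snd a)) + t *\<^sub>R (fst b, fst (snd b)) \<in> Omega G"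
      using * by (intro convexD[OF convex_Omega]) (auto simp: Omega_plus_def)
    moreover have "0 \<le> s *\<^sub>R snd (snd a) + t *\<^sub>R snd (snd b)"
      using * by (auto simp: Omega_plus_def less_eq_vec_def)
    ultimately show "s *\<^sub>R a + t *\<^sub>R b \<in> Omega_plus G"
      by (auto simp: Omega_plus_def case_prod_beta)
  qed
  moreover have "(fst b, snd b, c) \<in> Omega_plus G" using assms by (simp add: Omega_plus_def)
  ultimately show ?thesis
    using limiting_normal_cone_convex[OF _ normal[of k]] by (fastforce simp: inner_prod_def)
qed

text \<open>Only one coordinate of \<open>z\<close> is moved: the step 1 gives the sign, and the
  step back to zero gives equality when the coordinate is positive.\<close>

lemma normal_z:
  "snd (snd (\<nu> k)) $ i \<le> 0" "z k $ i > 0 \<Longrightarrow> snd (snd (\<nu> k)) $ i = 0"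
proof -
  let ?n = "snd (snd (\<nu> k)) $ i"
  have step: "?n * t \<le> 0" if "0 \<le> z k $ i + t" for t
  proof -
    have "0 \<le> z k + axis i t"
      using z_nonneg(2)[of k] that by (auto simp: less_eq_vec_def axis_def)
    from normal_inequality[OF in_Omega(1)[of k] this, of k]
    show ?thesis by (simp add: inner_axis)
  qed
  show "?n \<le> 0" using step[of 1] z_nonneg(2)[of k i] by simp
  then show "?n = 0" if "z k $ i > 0"
    using step[of "- z k $ i"] that by (simp add: zero_le_mult_iff)
qed

definition "is_multiplier k \<mu> \<longleftrightarrow> 0 \<le> \<mu> \<and> (\<forall>i. \<mu> $ i * G (x k, y k) $ i = 0)
  \<and> (fst (\<nu> k), fst (snd (\<nu> k))) = jacT G (x k, y k) \<mu>"

text \<open>Multipliers are guaranteed only for large \<open>k\<close>; the choice operator still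
  gives a total sequence, whose early values do not affect limits.\<close>

definition "M k = (SOME \<mu>. is_multiplier k \<mu>)"

lemma GDERIV_V:
  "a \<in> V \<Longrightarrow> GDERIV (\<lambda>w. G w $ i) a :> grad (\<lambda>w. G w $ i) a"
  using V(4) cont_diff_on_GDERIV by blast

lemma isCont_V:
  assumes "a \<in> V"
  shows "isCont (\<lambda>w. G w $ i) a" "isCont (grad (\<lambda>w. G w $ i)) a" "isCont (grad F) a"
  using assms V cont_diff_on_isCont cont_diff_on_isCont_grad by blast+

text \<open>The descent direction from MFCQ at the limit serves all late points: constraints
  inactive at the limit stay inactive, and the gradients of the others are continuous.\<close>

lemma eventually_is_multiplier: "\<forall>\<^sub>F k in sequentially. is_multiplier k (M k)"
proof -
  obtain d where d: "\<And>i. G (xbar, ybar) $ i = 0 \<Longrightarrow> grad (\<lambda>w. G w $ i) (xbar, ybar) \<bullet> d < 0"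
    using mfcq_ineq_descent[OF mfcq_upper] by blast
  have "\<forall>\<^sub>F k in sequentially. G (x k, y k) $ i = 0 \<longrightarrow> grad (\<lambda>w. G w $ i) (x k, y k) \<bullet> d < 0" for i
  proof (cases "G (xbar, ybar) $ i = 0")
    case True
    have "(\<lambda>k. grad (\<lambda>w. G w $ i) (x k, y k) \<bullet> d) \<longlonglongrightarrow> grad (\<lambda>w. G w $ i) (xbar, ybar) \<bullet> d"
      by (intro tendsto_intros isCont_tendsto_compose[OF isCont_V(2)] in_V pair_tendsto)
    from order_tendstoD(2)[OF this d[OF True]] show ?thesis by (rule eventually_mono) simp
  next
    case False
    have "(\<lambda>k. G (x k, y k) $ i) \<longlonglongrightarrow> G (xbar, ybar) $ i"
      by (intro isCont_tendsto_compose[OF isCont_V(1)] in_V pair_tendsto)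
    moreover have "G (xbar, ybar) $ i < 0"
      using bar_in_Omega(2) False by (simp add: less_eq_vec_def order_less_le)
    ultimately have "\<forall>\<^sub>F k in sequentially. G (x k, y k) $ i < 0" by (rule order_tendstoD(2))
    then show ?thesis by (rule eventually_mono) simp
  qed
  then have "\<forall>\<^sub>F k in sequentially. \<forall>i. G (x k, y k) $ i = 0 \<longrightarrow> grad (\<lambda>w. G w $ i) (x k, y k) \<bullet> d < 0"
    by (simp add: eventually_all_finite)
  then show ?thesis
  proof (rule eventually_mono)
    fix k assume k: "\<forall>i. G (x k, y k) $ i = 0 \<longrightarrow> grad (\<lambda>w. G w $ i) (x k, y k) \<bullet> d < 0"
    have "\<exists>\<mu>. is_multiplier k \<mu>" unfolding is_multiplier_def
    proof (rule normal_multipliers)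
      show "GDERIV (\<lambda>w. G w $ i) (x k, y k) :> grad (\<lambda>w. G w $ i) (x k, y k)" for i
        by (intro GDERIV_V in_V)
      show "(fst (\<nu> k), fst (snd (\<nu> k))) \<bullet> (b - (x k, y k)) \<le> 0" if "G b \<le> 0" for b
        using normal_inequality[of b "z k" k] that z_nonneg(1)[of k]
        by (cases b) (simp add: Omega_def inner_prod_def)
    qed (use k in_Omega in auto)
    then show "is_multiplier k (M k)" unfolding M_def by (rule someI_ex)
  qed
qed

section \<open>The approximate stationarity condition in components\<close>

lemma gap_grad_parts:
  "gap_grad f g \<gamma>1 \<gamma>2 (x k, y k, z k) =
    (fst (gradL (l k) (x k, y k) - gradL (z k) (x k, \<theta> k)),
     snd (gradL (l k) (x k, y k) - gradL (z k) (x k, \<theta> k)),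
     (1 / \<gamma>2) *\<^sub>R (l k - z k) - g (x k, \<theta> k))"
proof -
  \<comment> \<open>Gradients of sections are projections of full gradients. With
    \<open>theta_stationary\<close> for the proximal term, the first two components become those of
    a single difference of Lagrangian gradients.\<close>
  have "grad (\<lambda>x'. f (x', v)) (x k) = fst (grad f (x k, v))"
    "grad (\<lambda>x'. g (x', v) $ i) (x k) = fst (grad (\<lambda>w. g w $ i) (x k, v))"
    "grad (\<lambda>y'. f (x k, y')) v = snd (grad f (x k, v))"
    "grad (\<lambda>y'. g (x k, y') $ i) v = snd (grad (\<lambda>w. g w $ i) (x k, v))" for v i
    by (intro grad_eqI GDERIV_fst_section GDERIV_snd_section GDERIV_W in_W
          GDERIV_fst_section[where h = "\<lambda>w. g w $ i"] GDERIV_snd_section[where h = "\<lambda>w. g w $ i"])+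
  then show ?thesis
    unfolding gap_grad_def \<theta>_def[symmetric] l_def[symmetric] Let_def prod.case theta_stationary
    by (simp add: gradL_def jacT_def fst_sum snd_sum \<theta>_def[symmetric] l_def[symmetric] theta_stationary
        algebra_simps)
qed

lemma stationarity_xy:
  assumes "is_multiplier k (M k)"
  shows "(fst (\<epsilon> k), fst (snd (\<epsilon> k))) = grad F (x k, y k)
    + \<rho> k *\<^sub>R (gradL (l k) (x k, y k) - gradL (z k) (x k, \<theta> k)) + jacT G (x k, y k) (M k)"
proof -
  have "jacT G (x k, y k) (M k) = (fst (\<nu> k), fst (snd (\<nu> k)))"
    using assms by (simp add: is_multiplier_def)
  then show ?thesis unfolding approx_stationary[of k] gap_grad_parts
    by (simp add: prod_eq_iff)
qed

lemma stationarity_z: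
  "snd (snd (\<epsilon> k)) $ i
    = \<rho> k * ((l k $ i - z k $ i) / \<gamma>2 - g (x k, \<theta> k) $ i) + snd (snd (\<nu> k)) $ i"
  unfolding approx_stationary[of k] gap_grad_parts by simp

text \<open>Every index satisfies the approximate sign condition behind C-stationarity, whatever
  the branch of the projection; only its limit distinguishes the index sets.\<close>

lemma eta_product_lower_bound:
  "\<eta> k $ i * (\<rho> k * (g (x k, y k) $ i - g (x k, \<theta> k) $ i)) \<ge> - \<bar>\<eta> k $ i\<bar> * \<bar>snd (snd (\<epsilon> k)) $ i\<bar>"
proof -
  let ?a = "\<rho> k * (g (x k, y k) $ i - g (x k, \<theta> k) $ i)"
  let ?e = "snd (snd (\<epsilon> k)) $ i" and ?n = "snd (snd (\<nu> k)) $ i"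
  have eta: "\<eta> k $ i = \<rho> k * (l k $ i - z k $ i)" by (simp add: \<eta>_def)
  \<comment> \<open>Each alternative implies that \<open>\<eta> k $ i * ?a\<close> is at least
    \<open>\<eta> k $ i * ?e\<close>. They arise from the two branches of the projection, each split
    by whether \<open>z k $ i\<close> is positive.\<close>
  have "?a = ?e \<or> \<eta> k $ i = 0 \<or> (\<eta> k $ i \<ge> 0 \<and> ?a \<ge> ?e) \<or> (\<eta> k $ i \<le> 0 \<and> ?a \<le> ?e)"
  proof (cases "z k $ i + \<gamma>2 * g (x k, y k) $ i \<ge> 0")
    case True
    then have "(l k $ i - z k $ i) / \<gamma>2 = g (x k, y k) $ i"
      using gamma_pos by (simp add: l_nth)
    then have e: "?e = ?a + ?n" by (simp add: stationarity_z)
    show ?thesis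
    proof (cases "z k $ i > 0")
      case True then show ?thesis using e normal_z(2) by simp
    next
      case False
      then have "\<eta> k $ i \<ge> 0" using z_nonneg(2)[of k i] rho_pos[of k] by (simp add: eta l_nth)
      then show ?thesis using e normal_z(1)[of k i] by simp
    qed
  next
    case False
    then have l0: "l k $ i = 0" by (simp add: l_nth)
    show ?thesis
    proof (cases "z k $ i > 0")
      case True
      have "g (x k, y k) $ i \<le> - z k $ i / \<gamma>2" using False gamma_pos by (simp add: field_simps)
      then have "?a \<le> \<rho> k * (- z k $ i / \<gamma>2 - g (x k, \<theta> k) $ i)"
        using rho_pos[of k] by (intro mult_left_mono) auto
      also have "\<dots> = ?e" using normal_z(2)[OF True] by (simp add: stationarity_z l0)
      finally have "?a \<le> ?e" .
      moreover have "\<eta> k $ i \<le> 0" using True rho_pos[of k] by (simp add: eta l0)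
      ultimately show ?thesis by simp
    next
      case False
      then show ?thesis using z_nonneg(2)[of k i] by (simp add: eta l0)
    qed
  qed
  then have "\<eta> k $ i * ?a \<ge> \<eta> k $ i * ?e"
    by (auto intro: mult_left_mono mult_left_mono_neg)
  moreover have "\<eta> k $ i * ?e \<ge> - \<bar>\<eta> k $ i\<bar> * \<bar>?e\<bar>"
    by (metis abs_ge_minus_self abs_mult minus_le_iff mult_minus_left)
  ultimately show ?thesis by linarith
qed

text \<open>Eventually the projection clips to zero. A positive \<open>z k $ i\<close> would then
  annihilate the normal component, and the error would equal \<open>\<rho> k\<close> times a
  quantity with positive limit, contradicting its convergence to zero.\<close>

lemma eventually_eta_zero:
  assumes "filterlim \<rho> at_top sequentially" "i \<in> I_0p g (xbar, ybar, zbar)"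
  shows "\<forall>\<^sub>F k in sequentially. \<eta> k $ i = 0"
proof -
  let ?g = "g (xbar, ybar) $ i"
  have i: "zbar $ i = 0" "?g < 0" using assms(2) by (auto simp: I_0p_def)
  have "(\<lambda>k. z k $ i + \<gamma>2 * g (x k, y k) $ i) \<longlonglongrightarrow> zbar $ i + \<gamma>2 * ?g"
    by (intro tendsto_intros lim tendsto_g pair_tendsto)
  moreover have "zbar $ i + \<gamma>2 * ?g < 0" using i gamma_pos by (simp add: mult_pos_neg)
  ultimately have l0: "\<forall>\<^sub>F k in sequentially. z k $ i + \<gamma>2 * g (x k, y k) $ i < 0"
    by (rule order_tendstoD(2))
  have "(\<lambda>k. - z k $ i / \<gamma>2 - g (x k, \<theta> k) $ i) \<longlonglongrightarrow> - zbar $ i / \<gamma>2 - ?g"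
    using gamma_pos by (intro tendsto_intros lim tendsto_g pair_tendsto) auto
  moreover have "- zbar $ i / \<gamma>2 - ?g > 0" using i by simp
  ultimately have "filterlim (\<lambda>k. (- z k $ i / \<gamma>2 - g (x k, \<theta> k) $ i) * \<rho> k) at_top sequentially"
    using assms(1) by (rule filterlim_tendsto_pos_mult_at_top)
  then have big: "\<forall>\<^sub>F k in sequentially. (- z k $ i / \<gamma>2 - g (x k, \<theta> k) $ i) * \<rho> k > 1"
    by (simp add: filterlim_at_top_dense)
  have "(\<lambda>k. snd (snd (\<epsilon> k)) $ i) \<longlonglongrightarrow> 0"
    using tendsto_vec_nth[OF tendsto_snd[OF tendsto_snd[OF lim(4)]]] by simp
  then have "\<forall>\<^sub>F k in sequentially. snd (snd (\<epsilon> k)) $ i < 1" by (rule order_tendstoD) simp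
  with l0 big show ?thesis
  proof eventually_elim
    case (elim k)
    have l: "l k $ i = 0" using elim(1) by (simp add: l_nth)
    have "z k $ i = 0"
    proof (rule ccontr)
      assume "z k $ i \<noteq> 0"
      then have "snd (snd (\<nu> k)) $ i = 0" using z_nonneg(2)[of k i] by (intro normal_z(2)) simp
      then show False using elim(2,3) stationarity_z[of k i] l by (simp add: mult.commute)
    qed
    with l show ?case by (simp add: \<eta>_def)
  qed
qed

text \<open>Positivity of \<open>zbar $ i\<close> eventually rules out clipping and annihilates the
  normal component, so only the scaled difference remains.\<close>

lemma eventually_difference_eq:
  assumes "i \<in> I_p0 g (xbar, ybar, zbar)"
  shows "\<forall>\<^sub>F k in sequentially. \<rho> k * (g (x k, y k) $ i - g (x k, \<theta> k) $ i) = snd (snd (\<epsilon> k)) $ i"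
proof -
  have i: "zbar $ i > 0" using assms by (auto simp: I_p0_def)
  have "(\<lambda>k. l k $ i) \<longlonglongrightarrow> zbar $ i" "(\<lambda>k. z k $ i) \<longlonglongrightarrow> zbar $ i"
    by (intro tendsto_intros l_tendsto lim)+
  then have "\<forall>\<^sub>F k in sequentially. l k $ i > 0" "\<forall>\<^sub>F k in sequentially. z k $ i > 0"
    using i by (auto dest: order_tendstoD(1))
  then show ?thesis
  proof eventually_elim
    case (elim k)
    then have "(l k $ i - z k $ i) / \<gamma>2 = g (x k, y k) $ i"
      using gamma_pos by (simp add: l_nth max_def split: if_splits)
    then show ?case using normal_z(2)[OF elim(2)] by (simp add: stationarity_z)
  qed
qed


section \<open>The Hessian of the Lagrangian and the limit of the stationarity equation\<close>

lemma frechet_W: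
  "(grad f has_derivative frechet_derivative (grad f) (at (xbar, ybar))) (at (xbar, ybar))"
  "(grad (\<lambda>w. g w $ i) has_derivative frechet_derivative (grad (\<lambda>w. g w $ i)) (at (xbar, ybar)))
     (at (xbar, ybar))"
  using cont_diff_W(3,4) cont_diff_on_has_derivative[OF _ in_W(2)]
  by (auto simp: frechet_derivative_works[symmetric] differentiable_def)

lemma gradL_has_derivative: "(gradL zbar has_derivative hessL) (at (xbar, ybar))"
  unfolding gradL_def[abs_def] hessL_def[abs_def] jacT_def
  by (intro has_derivative_add has_derivative_sum has_derivative_scaleR_right frechet_W)

lemma linear_hessL: "linear hessL"
  using gradL_has_derivative has_derivative_linear by blast

text \<open>MPCC-MFCQ involves the derivative of the lower-level gradient paired with the
  multiplier, the stationarity equation the Hessian applied to it; symmetry identifies the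
  two.\<close>

lemma hessL_symmetric: "hessL u \<bullet> v = hessL v \<bullet> u"
proof -
  have "frechet_derivative (grad f) (at (xbar, ybar)) u \<bullet> v
      = frechet_derivative (grad f) (at (xbar, ybar)) v \<bullet> u"
    by (rule grad_derivative_symmetric[OF W(1) in_W(2) W(3) frechet_W(1)])
  moreover have "frechet_derivative (grad (\<lambda>w. g w $ i)) (at (xbar, ybar)) u \<bullet> v
      = frechet_derivative (grad (\<lambda>w. g w $ i)) (at (xbar, ybar)) v \<bullet> u" for i
    by (rule grad_derivative_symmetric[OF W(1) in_W(2) W(4) frechet_W(2)])
  ultimately show ?thesis by (simp add: hessL_def inner_add_left inner_sum_left)
qed

text \<open>\<open>W\<close> contains the whole fibre over \<open>xbar\<close>, so the gradient
  formula holds for all \<open>y'\<close> and the chain rule along the fibre applies.\<close>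

lemma frechet_grad_lagrangian:
  "frechet_derivative (\<lambda>y'. grad (\<lambda>(x'', y''). lagr f g x'' y'' zbar) (xbar, y')) (at ybar) v
    = hessL (0, v)"
proof -
  have "(\<lambda>y'. grad (\<lambda>(x'', y''). lagr f g x'' y'' zbar) (xbar, y')) = (\<lambda>y'. gradL zbar (xbar, y'))"
    using GDERIV_lagrangian[OF in_W(2), of zbar]
    by (auto simp: lagr_def case_prod_unfold intro!: grad_eqI)
  moreover have "((\<lambda>y'. gradL zbar (xbar, y')) has_derivative (\<lambda>v. hessL (0, v))) (at ybar)"
    by (rule has_derivative_compose[where f = "\<lambda>y'. (xbar, y')", OF _ gradL_has_derivative])
       (auto intro!: derivative_eq_intros)
  ultimately show ?thesis
    using frechet_derivative_at by (metis (no_types, lifting))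
qed

lemma grad_lower_g:
  "grad (\<lambda>y'. g (xbar, y') $ i) ybar \<bullet> v = grad (\<lambda>w. g w $ i) (xbar, ybar) \<bullet> (0, v)"
proof -
  have "grad (\<lambda>y'. g (xbar, y') $ i) ybar = snd (grad (\<lambda>w. g w $ i) (xbar, ybar))"
    by (intro grad_eqI GDERIV_snd_section[where h = "\<lambda>w. g w $ i"] GDERIV_W in_W)
  then show ?thesis by (simp add: inner_prod_def)
qed

text \<open>One passage to the limit for both regimes of \<open>\<rho>\<close>: only the scaled
  multipliers have to converge. The limit \<open>\<tau>\<close> stays in front of the gradient of
  \<open>F\<close> and may still be zero.\<close>

lemma limit_stationarity:
  assumes r: "strict_mono r" and nonneg: "\<And>k. 0 \<le> \<sigma> k"
    and \<sigma>: "\<sigma> \<longlonglongrightarrow> \<tau>" and \<mu>: "(\<lambda>k. \<sigma> k *\<^sub>R M (r k)) \<longlonglongrightarrow> \<mu>"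
    and w: "(\<lambda>k. \<sigma> k *\<^sub>R \<omega> (r k)) \<longlonglongrightarrow> w" and e: "(\<lambda>k. \<sigma> k *\<^sub>R \<eta> (r k)) \<longlonglongrightarrow> e"
  shows "\<tau> *\<^sub>R grad F (xbar, ybar) + jacT G (xbar, ybar) \<mu> + hessL (0, w) + jacT g (xbar, ybar) e = 0"
    and "0 \<le> \<mu>" and "\<mu> $ j * G (xbar, ybar) $ j = 0"
proof -
  note sub = LIMSEQ_subseq_LIMSEQ[OF _ r, unfolded o_def]
  let ?b = "(xbar, ybar)"
  let ?p = "\<lambda>k. (x (r k), y (r k))" and ?q = "\<lambda>k. (x (r k), \<theta> (r k))"
  note pq = pair_tendsto[THEN sub]
  have ev: "\<forall>\<^sub>F k in sequentially. is_multiplier (r k) (M (r k))"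
    by (rule eventually_subseq[OF r eventually_is_multiplier])
  have Mi: "(\<lambda>k. \<sigma> k * M (r k) $ i) \<longlonglongrightarrow> \<mu> $ i" for i
    using tendsto_vec_nth[OF \<mu>, of i] by simp
  have "0 \<le> \<mu> $ i" for i
  proof (rule tendsto_lowerbound[OF Mi])
    show "\<forall>\<^sub>F k in sequentially. 0 \<le> \<sigma> k * M (r k) $ i"
      using ev by eventually_elim (auto simp: is_multiplier_def less_eq_vec_def nonneg)
  qed simp
  then show "0 \<le> \<mu>" by (simp add: less_eq_vec_def)
  have "(\<lambda>k. \<sigma> k * M (r k) $ j * G (?p k) $ j) \<longlonglongrightarrow> \<mu> $ j * G ?b $ j"
    by (intro tendsto_mult Mi isCont_tendsto_compose[OF isCont_V(1)] in_V pq)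
  moreover have "\<forall>\<^sub>F k in sequentially. \<sigma> k * M (r k) $ j * G (?p k) $ j = 0"
    using ev by eventually_elim (auto simp: is_multiplier_def)
  ultimately show "\<mu> $ j * G ?b $ j = 0"
    by (rule LIMSEQ_unique[OF _ tendsto_eventually])

  \<comment> \<open>Both points share their first component, so the scaled difference lives in the
    \<open>y\<close> direction.\<close>
  have diff: "(\<lambda>k. (\<sigma> k * \<rho> (r k)) *\<^sub>R (?p k - ?q k)) \<longlonglongrightarrow> (0, w)"
  proof -
    have "(\<sigma> k * \<rho> (r k)) *\<^sub>R (?p k - ?q k) = (0, \<sigma> k *\<^sub>R \<omega> (r k))" for k
      by (simp add: \<omega>_def)
    then show ?thesis by (auto intro!: tendsto_Pair w)
  qed
  have df: "(\<lambda>k. (\<sigma> k * \<rho> (r k)) *\<^sub>R (grad f (?p k) - grad f (?q k)))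
      \<longlonglongrightarrow> frechet_derivative (grad f) (at ?b) (0, w)"
    by (rule strict_derivative_limit[OF W(1) in_W(2) cont_diff_W(3) frechet_W(1) pq diff])
  have dg: "(\<lambda>k. (\<sigma> k * \<rho> (r k)) *\<^sub>R (grad (\<lambda>w. g w $ i) (?p k) - grad (\<lambda>w. g w $ i) (?q k)))
      \<longlonglongrightarrow> frechet_derivative (grad (\<lambda>w. g w $ i)) (at ?b) (0, w)" for i
    by (rule strict_derivative_limit[OF W(1) in_W(2) cont_diff_W(4) frechet_W(2) pq diff])
  have "\<sigma> k *\<^sub>R (\<rho> (r k) *\<^sub>R (gradL (l (r k)) (?p k) - gradL (z (r k)) (?q k)))
      = (\<sigma> k * \<rho> (r k)) *\<^sub>R (grad f (?p k) - grad f (?q k))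
      + (\<Sum>i\<in>UNIV. z (r k) $ i *\<^sub>R ((\<sigma> k * \<rho> (r k)) *\<^sub>R (grad (\<lambda>w. g w $ i) (?p k) - grad (\<lambda>w. g w $ i) (?q k))))
      + jacT g (?p k) (\<sigma> k *\<^sub>R \<eta> (r k))" (is "?L k = ?R k") for k
  proof -
    \<comment> \<open>Inserting \<open>jacT g (?p k) (z (r k))\<close> separates a difference
      between two points with equal multipliers, handled by strict differentiability, from a
      difference of multipliers at one point.\<close>
    have "gradL (l (r k)) (?p k) - gradL (z (r k)) (?q k) = (grad f (?p k) - grad f (?q k))
        + (jacT g (?p k) (z (r k)) - jacT g (?q k) (z (r k))) + jacT g (?p k) (l (r k) - z (r k))"
      by (simp add: gradL_def jacT_diff)
    then show ?thesis
      by (simp add: jacT_scaleR \<eta>_def scaleR_add_right)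
         (simp add: jacT_def scaleR_sum_right mult_ac flip: sum_subtractf scaleR_diff_right)
  qed
  moreover have "?R \<longlonglongrightarrow> frechet_derivative (grad f) (at ?b) (0, w)
      + (\<Sum>i\<in>UNIV. zbar $ i *\<^sub>R frechet_derivative (grad (\<lambda>w. g w $ i)) (at ?b) (0, w))
      + jacT g ?b e"
    by (intro tendsto_add tendsto_sum tendsto_scaleR tendsto_vec_nth df dg lim[THEN sub]
        tendsto_jacT isCont_W in_W pq e)
  ultimately have L: "?L \<longlonglongrightarrow> hessL (0, w) + jacT g ?b e"
    by (simp add: hessL_def)
  have "(\<lambda>k. \<sigma> k *\<^sub>R grad F (?p k) + ?L k + jacT G (?p k) (\<sigma> k *\<^sub>R M (r k)))
      \<longlonglongrightarrow> \<tau> *\<^sub>R grad F ?b + (hessL (0, w) + jacT g ?b e) + jacT G ?b \<mu>"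
    by (intro tendsto_add tendsto_scaleR \<sigma> L \<mu> tendsto_jacT isCont_V in_V pq
        isCont_tendsto_compose[OF isCont_V(3)])
  moreover have "(\<lambda>k. (fst (\<epsilon> (r k)), fst (snd (\<epsilon> (r k))))) \<longlonglongrightarrow> (0, 0)"
    using tendsto_Pair[OF tendsto_fst[OF lim(4)[THEN sub]] tendsto_fst[OF tendsto_snd[OF lim(4)[THEN sub]]]]
    by simp
  from tendsto_scaleR[OF \<sigma> this]
  have "(\<lambda>k. \<sigma> k *\<^sub>R (fst (\<epsilon> (r k)), fst (snd (\<epsilon> (r k))))) \<longlonglongrightarrow> 0"
    by (simp flip: zero_prod_def)
  then have "(\<lambda>k. \<sigma> k *\<^sub>R grad F (?p k) + ?L k + jacT G (?p k) (\<sigma> k *\<^sub>R M (r k))) \<longlonglongrightarrow> 0"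
  proof (rule Lim_transform_eventually)
    show "\<forall>\<^sub>F k in sequentially. \<sigma> k *\<^sub>R (fst (\<epsilon> (r k)), fst (snd (\<epsilon> (r k))))
        = \<sigma> k *\<^sub>R grad F (?p k) + ?L k + jacT G (?p k) (\<sigma> k *\<^sub>R M (r k))"
      using ev by eventually_elim (simp only: stationarity_xy jacT_scaleR scaleR_add_right)
  qed
  ultimately have "\<tau> *\<^sub>R grad F ?b + (hessL (0, w) + jacT g ?b e) + jacT G ?b \<mu> = 0"
    by (rule LIMSEQ_unique)
  then show "\<tau> *\<^sub>R grad F ?b + jacT G ?b \<mu> + hessL (0, w) + jacT g ?b e = 0"
    by (simp add: algebra_simps)
qed

section \<open>Normalized multipliers and the two stationarity conclusions\<close>

lemma mpcc_multiplierI: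
  assumes stat: "\<tau> *\<^sub>R grad F (xbar, ybar) + jacT G (xbar, ybar) \<mu> + hessL (0, w) + jacT g (xbar, ybar) e = 0"
    and "\<tau> > 0" "0 \<le> \<mu>" "\<And>j. \<mu> $ j * G (xbar, ybar) $ j = 0"
    and "\<And>i. i \<in> I_0p g (xbar, ybar, zbar) \<Longrightarrow> e $ i = 0"
    and "\<And>i. i \<in> I_p0 g (xbar, ybar, zbar) \<Longrightarrow> grad (\<lambda>w. g w $ i) (xbar, ybar) \<bullet> (0, w) = 0"
  shows "mpcc_multiplier F f G g (xbar, ybar, zbar) ((1 / \<tau>) *\<^sub>R \<mu>) ((1 / \<tau>) *\<^sub>R w) ((1 / \<tau>) *\<^sub>R e)"
proof -
  have "hessL (0, (1 / \<tau>) *\<^sub>R w) = (1 / \<tau>) *\<^sub>R hessL (0, w)"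
    using linear_scale[OF linear_hessL, of "1 / \<tau>" "(0, w)"] by simp
  then have "grad F (xbar, ybar) + jacT G (xbar, ybar) ((1 / \<tau>) *\<^sub>R \<mu>) + hessL (0, (1 / \<tau>) *\<^sub>R w)
      + jacT g (xbar, ybar) ((1 / \<tau>) *\<^sub>R e)
      = (1 / \<tau>) *\<^sub>R (\<tau> *\<^sub>R grad F (xbar, ybar) + jacT G (xbar, ybar) \<mu> + hessL (0, w) + jacT g (xbar, ybar) e)"
    using \<open>\<tau> > 0\<close> by (simp add: jacT_scaleR scaleR_add_right)
  then have "0 = grad F (xbar, ybar) + jacT G (xbar, ybar) ((1 / \<tau>) *\<^sub>R \<mu>) + hessL (0, (1 / \<tau>) *\<^sub>R w)
      + jacT g (xbar, ybar) ((1 / \<tau>) *\<^sub>R e)"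
    by (simp add: stat)
  moreover have "grad (\<lambda>w. g w $ i) (xbar, ybar) \<bullet> (0, (1 / \<tau>) *\<^sub>R w)
      = 1 / \<tau> * (grad (\<lambda>w. g w $ i) (xbar, ybar) \<bullet> (0, w))" for i
    by (simp add: inner_prod_def)
  ultimately show ?thesis
    using assms(2-) by (simp add: mpcc_multiplier_def frechet_grad_lagrangian grad_lower_g less_eq_vec_def)
qed

text \<open>Bounded factors times vanishing distances tend to zero, so only \<open>M\<close> is
  normalized. MFCQ for \<open>G\<close> excludes \<open>\<tau> = 0\<close>, and zero values of both
  remaining multipliers satisfy every sign condition.\<close>

lemma S_stationary_limit:
  assumes "bounded (range \<rho>)"
  shows "S_stationary F f G g (xbar, ybar, zbar)"
proof -
  obtain r \<sigma> \<tau> \<mu> where r: "strict_mono r" and \<sigma>01: "\<And>k. 0 \<le> \<sigma> k" "\<And>k. \<sigma> k \<le> 1"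
    and \<sigma>: "\<sigma> \<longlonglongrightarrow> \<tau>" and \<mu>: "(\<lambda>k. \<sigma> k *\<^sub>R M (r k)) \<longlonglongrightarrow> \<mu>"
    and \<tau>: "0 \<le> \<tau>" "\<tau> = 0 \<Longrightarrow> norm \<mu> = 1"
    using scaled_convergent_subsequence[of M] by blast
  obtain B where B: "\<And>k. \<bar>\<rho> k\<bar> \<le> B" using assms by (auto simp: bounded_iff)
  have scale: "(\<lambda>k. \<sigma> k *\<^sub>R (\<rho> (r k) *\<^sub>R v (r k))) \<longlonglongrightarrow> 0" if "v \<longlonglongrightarrow> 0" for v :: "nat \<Rightarrow> 'b::real_normed_vector"
  proof -
    have "(\<lambda>k. v (r k)) \<longlonglongrightarrow> 0" using LIMSEQ_subseq_LIMSEQ[OF that r] by (simp add: o_def)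
    moreover have "Bfun (\<lambda>k. \<sigma> k * \<rho> (r k)) sequentially"
    proof (rule BfunI[OF always_eventually], rule allI)
      fix k
      have "\<bar>\<sigma> k\<bar> * \<bar>\<rho> (r k)\<bar> \<le> 1 * B" using \<sigma>01[of k] B[of "r k"] by (intro mult_mono) auto
      then show "norm (\<sigma> k * \<rho> (r k)) \<le> B" by (simp add: abs_mult)
    qed
    ultimately have "(\<lambda>k. (\<sigma> k * \<rho> (r k)) *\<^sub>R v (r k)) \<longlonglongrightarrow> 0"
      using bounded_bilinear.Bfun_prod_Zfun[OF bounded_bilinear_scaleR]
      by (simp add: tendsto_Zfun_iff)
    then show ?thesis by simp
  qed
  have w: "(\<lambda>k. \<sigma> k *\<^sub>R \<omega> (r k)) \<longlonglongrightarrow> 0" and e: "(\<lambda>k. \<sigma> k *\<^sub>R \<eta> (r k)) \<longlonglongrightarrow> 0"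
    unfolding \<omega>_def \<eta>_def by (intro scale gap_parts_tendsto)+
  note st = limit_stationarity[OF r \<sigma>01(1) \<sigma> \<mu> w e]
  have "\<tau> \<noteq> 0"
  proof
    assume \<tau>0: "\<tau> = 0"
    then have "jacT G (xbar, ybar) \<mu> = 0"
      using st(1) linear_0[OF linear_hessL] by (simp flip: zero_prod_def)
    then have "\<mu> = 0" by (rule mfcq_ineqD[OF mfcq_upper st(2,3)])
    then show False using \<tau>(2)[OF \<tau>0] by simp
  qed
  with \<tau>(1) have "\<tau> > 0" by simp
  have "mpcc_multiplier F f G g (xbar, ybar, zbar) ((1 / \<tau>) *\<^sub>R \<mu>) ((1 / \<tau>) *\<^sub>R 0) ((1 / \<tau>) *\<^sub>R 0)"
    by (rule mpcc_multiplierI[OF st(1) \<open>\<tau> > 0\<close> st(2,3)]) (simp_all add: inner_prod_def)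
  then show ?thesis
    unfolding S_stationary_def prod.case
    by (intro conjI[OF mpcc_feasible_limit] exI conjI ballI) (assumption | simp)+
qed

text \<open>From the homogeneous stationarity equation in the variables \<open>x\<close> and
  \<open>y\<close>, multipliers for the full system in three variables are built; the
  \<open>z\<close> components are balanced by the constraints that fix \<open>z $ i\<close> at
  zero.\<close>

lemma mpcc_mfcqD:
  assumes mfcq: "mpcc_mfcq f G g (xbar, ybar, zbar)"
    and stat: "jacT G (xbar, ybar) \<mu> + hessL (0, w) + jacT g (xbar, ybar) e = 0"
    and \<mu>: "0 \<le> \<mu>" "\<And>j. \<mu> $ j * G (xbar, ybar) $ j = 0"
    and e: "\<And>i. i \<in> I_0p g (xbar, ybar, zbar) \<Longrightarrow> e $ i = 0"
    and w: "\<And>i. i \<in> I_p0 g (xbar, ybar, zbar) \<Longrightarrow> grad (\<lambda>w. g w $ i) (xbar, ybar) \<bullet> (0, w) = 0"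
  shows "\<mu> = 0" "w = 0" "e = 0"
proof -
  let ?b = "(xbar, ybar)" and ?wb = "(xbar, ybar, zbar)"
  let ?Ip0 = "I_p0 g ?wb" and ?I0p = "I_0p g ?wb" and ?I00 = "I_00 g ?wb"
  define hL :: "'m \<Rightarrow> (real^'n) \<times> (real^'m) \<times> (real^'q) \<Rightarrow> real"
    where "hL = (\<lambda>j (x, y, z). grad (\<lambda>y'. lagr f g x y' z) y $ j)"
  define hg :: "'q \<Rightarrow> (real^'n) \<times> (real^'m) \<times> (real^'q) \<Rightarrow> real"
    where "hg = (\<lambda>i (x, y, z). - (g (x, y) $ i))"
  define hz :: "'q \<Rightarrow> (real^'n) \<times> (real^'m) \<times> (real^'q) \<Rightarrow> real"
    where "hz = (\<lambda>i (x, y, z). z $ i)"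
  define cG :: "'p \<Rightarrow> (real^'n) \<times> (real^'m) \<times> (real^'q) \<Rightarrow> real"
    where "cG = (\<lambda>j (x, y, z). G (x, y) $ j)"
  define cg :: "'q \<Rightarrow> (real^'n) \<times> (real^'m) \<times> (real^'q) \<Rightarrow> real"
    where "cg = (\<lambda>i (x, y, z). g (x, y) $ i)"
  define cz :: "'q \<Rightarrow> (real^'n) \<times> (real^'m) \<times> (real^'q) \<Rightarrow> real"
    where "cz = (\<lambda>i (x, y, z). - (z $ i))"
  define J where "J = (UNIV :: 'm set) <+> ((?Ip0 \<union> ?I00) <+> (?I0p \<union> ?I00))"
  define I where "I = (UNIV :: 'p set) <+> (?I0p <+> ?Ip0)"
  define h where "h = case_sum hL (case_sum hg hz)"
  define c where "c = case_sum cG (case_sum cg cz)"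
  \<comment> \<open>\<open>- e\<close> accounts for the sign of the constraint \<open>- g\<close>,
    and the last block is chosen to cancel the \<open>z\<close> derivative of the lower-level
    gradient paired with \<open>w\<close>.\<close>
  define \<mu>h where "\<mu>h = case_sum (\<lambda>j. w $ j)
      (case_sum (\<lambda>i. - e $ i) (\<lambda>i. - (grad (\<lambda>w. g w $ i) ?b \<bullet> (0, w))))"
  define \<mu>c where "\<mu>c = case_sum (\<lambda>j. \<mu> $ j) (\<lambda>_ :: 'q + 'q. 0)"
  have mf: "mfcq J h I c ?wb"
    using mfcq unfolding mpcc_mfcq_def J_def I_def h_def c_def hL_def hg_def hz_def cG_def cg_def cz_def .

  have proj: "((\<lambda>(x, y, z). (x, y)) has_derivative (\<lambda>(u, v, s). (u, v))) (at ?wb)"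
    unfolding case_prod_unfold by (auto intro!: derivative_eq_intros)
  have dxy: "((\<lambda>(x, y, z). h (x, y)) has_derivative (\<lambda>(u, v, s). D (u, v))) (at ?wb)"
    if "(h has_derivative D) (at ?b)"
    for h :: "(real^'n) \<times> (real^'m) \<Rightarrow> 'b::real_normed_vector" and D
  proof -
    have "((\<lambda>a. h ((\<lambda>(x, y, z). (x, y)) a)) has_derivative (\<lambda>a. D ((\<lambda>(u, v, s). (u, v)) a))) (at ?wb)"
      by (rule has_derivative_compose[OF proj]) (use that in simp)
    then show ?thesis by (simp add: case_prod_unfold)
  qed
  have dz: "((\<lambda>(x, y, z). z $ i) has_derivative (\<lambda>(u, v, s). s $ i)) (at ?wb)" for i
    unfolding case_prod_unfold
    by (auto intro!: derivative_eq_intros bounded_linear.has_derivative[OF bounded_linear_vec_nth])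
  have gG: "(u, v, s) \<bullet> grad (cG j) ?wb = (u, v) \<bullet> grad (\<lambda>w. G w $ j) ?b" for u v s j
    using has_derivative_inner_grad[OF dxy[OF GDERIV_V[OF in_V(2), of j, unfolded gderiv_def]]]
    by (simp add: cG_def)
  have gg: "(u, v, s) \<bullet> grad (hg i) ?wb = - ((u, v) \<bullet> grad (\<lambda>w. g w $ i) ?b)" for u v s i
    using has_derivative_inner_grad[OF has_derivative_minus[OF dxy[OF GDERIV_W(2)[OF in_W(2), of i, unfolded gderiv_def]]]]
    by (simp add: hg_def case_prod_unfold)
  have gz: "(u, v, s) \<bullet> grad (hz i) ?wb = s $ i" for u v s i
    using has_derivative_inner_grad[OF dz] by (simp add: hz_def)
  have gL: "(u, v, s) \<bullet> grad (hL j) ?wb = snd (hessL (u, v)) $ j + snd (jacT g ?b s) $ j" for u v s j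
  proof -
    have "((\<lambda>(x, y, z). gradL z (x, y)) has_derivative (\<lambda>(u, v, s). hessL (u, v) + jacT g ?b s)) (at ?wb)"
    proof -
      have "((\<lambda>a. (\<lambda>(x, y, z). grad f (x, y)) a + (\<Sum>i\<in>UNIV. (\<lambda>(x, y, z). z $ i) a *\<^sub>R (\<lambda>(x, y, z). grad (\<lambda>w. g w $ i) (x, y)) a))
         has_derivative (\<lambda>a. (\<lambda>(u, v, s). frechet_derivative (grad f) (at ?b) (u, v)) a
            + (\<Sum>i\<in>UNIV. (\<lambda>(x, y, z). z $ i) ?wb *\<^sub>R (\<lambda>(u, v, s). frechet_derivative (grad (\<lambda>w. g w $ i)) (at ?b) (u, v)) a
                + (\<lambda>(u, v, s). s $ i) a *\<^sub>R (\<lambda>(x, y, z). grad (\<lambda>w. g w $ i) (x, y)) ?wb))) (at ?wb)"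
        by (intro has_derivative_add has_derivative_sum has_derivative_scaleR dxy dz frechet_W)
      then show ?thesis
        by (simp add: gradL_def hessL_def jacT_def case_prod_unfold sum.distrib add.assoc)
    qed
    then have "((\<lambda>a. snd ((\<lambda>(x, y, z). gradL z (x, y)) a) $ j) has_derivative
        (\<lambda>a. snd ((\<lambda>(u, v, s). hessL (u, v) + jacT g ?b s) a) $ j)) (at ?wb)"
      by (intro bounded_linear.has_derivative[OF bounded_linear_vec_nth] has_derivative_snd)
    \<comment> \<open>\<open>hL j\<close> agrees with the explicit gradient formula only over
      \<open>W\<close>, hence the transfer within an open set.\<close>
    then have "(hL j has_derivative (\<lambda>a. snd ((\<lambda>(u, v, s). hessL (u, v) + jacT g ?b s) a) $ j)) (at ?wb)"
    proof (rule has_derivative_transform_within_open)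
      have "continuous_on UNIV (\<lambda>a :: (real^'n) \<times> (real^'m) \<times> (real^'q). (fst a, fst (snd a)))"
        by (intro continuous_intros)
      from open_vimage[OF W(1) this]
      show "open ((\<lambda>a :: (real^'n) \<times> (real^'m) \<times> (real^'q). (fst a, fst (snd a))) -` W)" .
    qed (auto simp: in_W hL_def grad_lower_lagrangian)
    from has_derivative_inner_grad[OF this] show ?thesis by simp
  qed

  \<comment> \<open>At the limit point the inequalities indexed by \<open>I_0p\<close> and
    \<open>I_p0\<close> are strict by definition of these sets, so only components of
    \<open>G\<close> can be active.\<close>
  have active: "{i \<in> I. c i ?wb = 0} = Inl ` {j. G ?b $ j = 0}"
    by (auto simp: I_def c_def cG_def cg_def cz_def I_0p_def I_p0_def elim!: PlusE)
  have e': "e $ i = 0" if "i \<notin> ?Ip0 \<union> ?I00" for i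
    using e index_partition[of i] that by blast
  have w': "grad (\<lambda>w. g w $ i) ?b \<bullet> (0, w) = 0" if "i \<notin> ?I0p \<union> ?I00" for i
    using w index_partition[of i] that by blast
  have \<mu>': "\<mu> $ j = 0" if "G ?b $ j \<noteq> 0" for j using \<mu>(2)[of j] that by simp
  have fin: "finite A" for A :: "'q set" by simp
  define S where "S = (\<Sum>j\<in>J. \<mu>h j *\<^sub>R grad (h j) ?wb)
      + (\<Sum>i\<in>{i \<in> I. c i ?wb = 0}. \<mu>c i *\<^sub>R grad (c i) ?wb)"
  have "S = 0"
  proof -
    have "(u, v, s) \<bullet> S = 0" for u v s
    proof -
      \<comment> \<open>Symmetry moves the Hessian from the test vector to \<open>(0, w)\<close>;
        the remaining sum in \<open>s\<close> is cancelled by the one in 3.\<close>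
      have 1: "(\<Sum>j\<in>UNIV. w $ j * ((u, v, s) \<bullet> grad (hL j) ?wb))
          = (u, v) \<bullet> hessL (0, w) + (\<Sum>i\<in>UNIV. s $ i * (grad (\<lambda>w. g w $ i) ?b \<bullet> (0, w)))"
      proof -
        have "(\<Sum>j\<in>UNIV. w $ j * ((u, v, s) \<bullet> grad (hL j) ?wb))
            = hessL (u, v) \<bullet> (0, w) + (0, w) \<bullet> jacT g ?b s"
          unfolding gL distrib_left sum.distrib
          by (simp add: inner_prod_def inner_vec_def[of w] inner_vec_def[of _ w] mult.commute)
        then show ?thesis
          using hessL_symmetric[of "(u, v)" "(0, w)"] by (simp add: inner_jacT inner_commute)
      qed
      have 2: "(\<Sum>i\<in>?Ip0 \<union> ?I00. - e $ i * ((u, v, s) \<bullet> grad (hg i) ?wb)) = (u, v) \<bullet> jacT g ?b e"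
        unfolding inner_jacT by (rule sum.mono_neutral_cong_left) (use e' in \<open>simp_all add: gg\<close>)
      have 3: "(\<Sum>i\<in>?I0p \<union> ?I00. - (grad (\<lambda>w. g w $ i) ?b \<bullet> (0, w)) * ((u, v, s) \<bullet> grad (hz i) ?wb))
          = - (\<Sum>i\<in>UNIV. s $ i * (grad (\<lambda>w. g w $ i) ?b \<bullet> (0, w)))"
        unfolding sum_negf[symmetric]
        by (rule sum.mono_neutral_cong_left) (use w' in \<open>simp_all add: gz\<close>)
      have 4: "(\<Sum>j | G ?b $ j = 0. \<mu> $ j * ((u, v, s) \<bullet> grad (cG j) ?wb)) = (u, v) \<bullet> jacT G ?b \<mu>"
        unfolding inner_jacT by (rule sum.mono_neutral_cong_left) (use \<mu>' in \<open>simp_all add: gG\<close>)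
      have "(u, v, s) \<bullet> S = (u, v) \<bullet> (jacT G ?b \<mu> + hessL (0, w) + jacT g ?b e)"
        unfolding S_def active J_def inner_add_right 2[symmetric] 4[symmetric]
        using 1 3
        by (simp add: sum.Plus fin sum.reindex inner_sum_right inner_add_right h_def c_def \<mu>h_def \<mu>c_def)
      then show ?thesis by (simp add: stat)
    qed
    from this[of "fst S" "fst (snd S)" "snd (snd S)"] have "S \<bullet> S = 0" by simp
    then show ?thesis by simp
  qed
  note this[unfolded S_def]
  moreover have "\<forall>i\<in>{i \<in> I. c i ?wb = 0}. 0 \<le> \<mu>c i"
    unfolding active using \<mu>(1) by (auto simp: \<mu>c_def less_eq_vec_def)
  ultimately have zero: "\<forall>j\<in>J. \<mu>h j = 0" "\<forall>i\<in>{i \<in> I. c i ?wb = 0}. \<mu>c i = 0"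
    using mf[unfolded mfcq_def, THEN conjunct2, THEN conjunct2, THEN spec[of _ \<mu>h], THEN spec[of _ \<mu>c]]
    by blast+
  have "w $ j = 0" for j
    using zero(1)[THEN bspec, of "Inl j"] by (simp add: J_def \<mu>h_def InlI)
  then show "w = 0" by (simp add: vec_eq_iff)
  have "\<mu> $ j = 0" for j
    using zero(2)[unfolded active, THEN bspec, of "Inl j"] \<mu>' by (cases "G ?b $ j = 0") (auto simp: \<mu>c_def)
  then show "\<mu> = 0" by (simp add: vec_eq_iff)
  have "e $ i = 0" for i
    using zero(1)[THEN bspec, of "Inr (Inl i)"] e'[of i] by (auto simp: J_def \<mu>h_def)
  then show "e = 0" by (simp add: vec_eq_iff)
qed

text \<open>All three multipliers are normalized jointly, since \<open>\<omega>\<close> and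
  \<open>\<eta>\<close> may be unbounded too. The sign information is passed to the limit first,
  because MPCC-MFCQ can exclude \<open>\<tau> = 0\<close> only with the index conditions at
  hand.\<close>

lemma C_stationary_limit:
  assumes \<rho>: "filterlim \<rho> at_top sequentially" and mfcq: "mpcc_mfcq f G g (xbar, ybar, zbar)"
  shows "C_stationary F f G g (xbar, ybar, zbar)"
proof -
  define T where "T k = (M k, \<omega> k, \<eta> k)" for k
  obtain r \<sigma> \<tau> t where r: "strict_mono r" and \<sigma>01: "\<And>k. 0 \<le> \<sigma> k" "\<And>k. \<sigma> k \<le> 1"
    and \<sigma>: "\<sigma> \<longlonglongrightarrow> \<tau>" and t: "(\<lambda>k. \<sigma> k *\<^sub>R T (r k)) \<longlonglongrightarrow> t"
    and \<tau>: "0 \<le> \<tau>" "\<tau> = 0 \<Longrightarrow> norm t = 1"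
    using scaled_convergent_subsequence[of T] by blast
  obtain \<mu> w e where t_eq: "t = (\<mu>, w, e)" by (cases t)
  note T = t[unfolded t_eq]
  have \<mu>: "(\<lambda>k. \<sigma> k *\<^sub>R M (r k)) \<longlonglongrightarrow> \<mu>" and w: "(\<lambda>k. \<sigma> k *\<^sub>R \<omega> (r k)) \<longlonglongrightarrow> w"
    and e: "(\<lambda>k. \<sigma> k *\<^sub>R \<eta> (r k)) \<longlonglongrightarrow> e"
    using tendsto_fst[OF T] tendsto_fst[OF tendsto_snd[OF T]] tendsto_snd[OF tendsto_snd[OF T]]
    by (simp_all add: T_def)
  note st = limit_stationarity[OF r \<sigma>01(1) \<sigma> \<mu> w e]
  let ?b = "(xbar, ybar)"
  let ?d = "\<lambda>i k. \<rho> k * (g (x k, y k) $ i - g (x k, \<theta> k) $ i)"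
  have ei: "(\<lambda>k. \<sigma> k * \<eta> (r k) $ i) \<longlonglongrightarrow> e $ i" for i
    using tendsto_vec_nth[OF e, of i] by simp
  \<comment> \<open>Strict differentiability identifies the scaled differences of \<open>g\<close>,
    which carry the sign information, with the pairing of its gradient and \<open>w\<close>.\<close>
  have d: "(\<lambda>k. \<sigma> k * ?d i (r k)) \<longlonglongrightarrow> grad (\<lambda>w. g w $ i) ?b \<bullet> (0, w)" for i
  proof -
    have "(\<lambda>k. (\<sigma> k * \<rho> (r k)) *\<^sub>R ((x (r k), y (r k)) - (x (r k), \<theta> (r k)))) \<longlonglongrightarrow> (0, w)"
      using tendsto_Pair[OF tendsto_const[of 0] w] by (simp add: \<omega>_def)
    from strict_derivative_limit[OF W(1) in_W(2) cont_diff_W(2)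
        GDERIV_W(2)[OF in_W(2), unfolded gderiv_def]
        pair_tendsto[THEN LIMSEQ_subseq_LIMSEQ[OF _ r, unfolded o_def]] this]
    show ?thesis by (simp add: inner_commute mult.assoc)
  qed
  have \<epsilon>: "(\<lambda>k. snd (snd (\<epsilon> (r k))) $ i) \<longlonglongrightarrow> 0" for i
    using tendsto_vec_nth[OF tendsto_snd[OF tendsto_snd[OF LIMSEQ_subseq_LIMSEQ[OF lim(4) r]]]]
    by (simp add: o_def)
  have e0: "e $ i = 0" if "i \<in> I_0p g (xbar, ybar, zbar)" for i
  proof (rule LIMSEQ_unique[OF ei tendsto_eventually])
    show "\<forall>\<^sub>F k in sequentially. \<sigma> k * \<eta> (r k) $ i = 0"
      using eventually_subseq[OF r eventually_eta_zero[OF \<rho> that]] by eventually_elim simp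
  qed
  have w0: "grad (\<lambda>w. g w $ i) ?b \<bullet> (0, w) = 0" if "i \<in> I_p0 g (xbar, ybar, zbar)" for i
  proof (rule LIMSEQ_unique[OF d])
    have "(\<lambda>k. \<sigma> k * snd (snd (\<epsilon> (r k))) $ i) \<longlonglongrightarrow> \<tau> * 0" by (intro tendsto_mult \<sigma> \<epsilon>)
    then have "(\<lambda>k. \<sigma> k * snd (snd (\<epsilon> (r k))) $ i) \<longlonglongrightarrow> 0" by simp
    then show "(\<lambda>k. \<sigma> k * ?d i (r k)) \<longlonglongrightarrow> 0"
    proof (rule Lim_transform_eventually)
      show "\<forall>\<^sub>F k in sequentially. \<sigma> k * snd (snd (\<epsilon> (r k))) $ i = \<sigma> k * ?d i (r k)"
        using eventually_subseq[OF r eventually_difference_eq[OF that]] by eventually_elim simp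
    qed
  qed
  \<comment> \<open>The lower bound is multiplied by the square of \<open>\<sigma> k\<close>, one
    factor for each of the two limits; the error bound then tends to zero.\<close>
  have prod: "0 \<le> e $ i * (grad (\<lambda>w. g w $ i) ?b \<bullet> (0, w))" for i
  proof -
    have "(\<lambda>k. \<sigma> k * \<eta> (r k) $ i * (\<sigma> k * ?d i (r k))) \<longlonglongrightarrow> e $ i * (grad (\<lambda>w. g w $ i) ?b \<bullet> (0, w))"
      by (intro tendsto_mult ei d)
    moreover have "(\<lambda>k. - \<bar>\<sigma> k * \<eta> (r k) $ i\<bar> * (\<sigma> k * \<bar>snd (snd (\<epsilon> (r k))) $ i\<bar>)) \<longlonglongrightarrow> - \<bar>e $ i\<bar> * (\<tau> * \<bar>0\<bar>)"
      by (intro tendsto_mult tendsto_minus tendsto_rabs ei \<sigma> \<epsilon>)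
    moreover have "- \<bar>\<sigma> k * \<eta> (r k) $ i\<bar> * (\<sigma> k * \<bar>snd (snd (\<epsilon> (r k))) $ i\<bar>)
        \<le> \<sigma> k * \<eta> (r k) $ i * (\<sigma> k * ?d i (r k))" for k
      using mult_left_mono[OF eta_product_lower_bound[of "r k" i], of "\<sigma> k * \<sigma> k"] \<sigma>01(1)[of k]
      by (simp add: abs_mult mult_ac)
    ultimately show ?thesis by (force dest: LIMSEQ_le)
  qed
  have "\<tau> \<noteq> 0"
  proof
    assume \<tau>0: "\<tau> = 0"
    then have "jacT G ?b \<mu> + hessL (0, w) + jacT g ?b e = 0" using st(1) by simp
    from mpcc_mfcqD[OF mfcq this st(2,3) e0 w0] have "t = 0" by (simp add: t_eq zero_prod_def)
    then show False using \<tau>(2)[OF \<tau>0] by simp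
  qed
  with \<tau>(1) have "\<tau> > 0" by simp
  have "mpcc_multiplier F f G g (xbar, ybar, zbar) ((1 / \<tau>) *\<^sub>R \<mu>) ((1 / \<tau>) *\<^sub>R w) ((1 / \<tau>) *\<^sub>R e)"
    by (rule mpcc_multiplierI[OF st(1) \<open>\<tau> > 0\<close> st(2,3) e0 w0])
  moreover have "0 \<le> ((1 / \<tau>) *\<^sub>R e) $ i * (grad (\<lambda>y'. g (xbar, y') $ i) ybar \<bullet> ((1 / \<tau>) *\<^sub>R w))" for i
    using prod[of i] \<open>\<tau> > 0\<close> by (simp add: grad_lower_g)
  ultimately show ?thesis
    unfolding C_stationary_def prod.case using mpcc_feasible_limit by blast
qed

end

section \<open>Reduction to a convergent subsequence\<close>

theorem theorem3p3:
  fixes F f :: "(real^'n) \<times> (real^'m) \<Rightarrow> real"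
    and G :: "(real^'n) \<times> (real^'m) \<Rightarrow> real^'p"
    and g :: "(real^'n) \<times> (real^'m) \<Rightarrow> real^'q"
    and \<gamma>1 \<gamma>2 :: real
    and x :: "nat \<Rightarrow> real^'n" and y :: "nat \<Rightarrow> real^'m" and z :: "nat \<Rightarrow> real^'q"
    and \<epsilon> :: "nat \<Rightarrow> (real^'n) \<times> (real^'m) \<times> (real^'q)"
    and \<rho> :: "nat \<Rightarrow> real"
    and xbar :: "real^'n" and ybar :: "real^'m" and zbar :: "real^'q"
  assumes F_C1: "\<exists>U. open U \<and> Omega G \<subseteq> U \<and> cont_diff_on U F"
    and G_C1_convex:
      "\<forall>i. \<exists>U. open U \<and> Omega G \<subseteq> U \<and> cont_diff_on U (\<lambda>w. G w $ i) \<and> convex_on U (\<lambda>w. G w $ i)"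
    and f_convex: "\<forall>u\<in>X_set G. convex_on UNIV (\<lambda>v. f (u, v))"
    and g_convex: "\<forall>u\<in>X_set G. \<forall>i. convex_on UNIV (\<lambda>v. g (u, v) $ i)"
    and f_C2: "\<exists>U. open U \<and> X_set G \<times> UNIV \<subseteq> U \<and> twice_cont_diff_on U f"
    and g_C2: "\<forall>i. \<exists>U. open U \<and> X_set G \<times> UNIV \<subseteq> U \<and> twice_cont_diff_on U (\<lambda>w. g w $ i)"
    and gamma_pos: "\<gamma>1 > 0" "\<gamma>2 > 0"
    and rho_pos: "\<forall>k. \<rho> k > 0"
    and xy_lim: "(\<lambda>k. (x k, y k)) \<longlonglongrightarrow> (xbar, ybar)"
    and eps_lim: "\<epsilon> \<longlonglongrightarrow> 0"
    and in_Omega_plus: "\<forall>k. (x k, y k, z k) \<in> Omega_plus G"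
    and gap_lim: "(\<lambda>k. gap f g \<gamma>1 \<gamma>2 (x k, y k, z k)) \<longlonglongrightarrow> 0"
    and approx_stationary:
      "\<forall>k. \<exists>\<nu> \<in> limiting_normal_cone (Omega_plus G) (x k, y k, z k).
         \<epsilon> k = (fst (grad F (x k, y k)), snd (grad F (x k, y k)), 0)
               + \<rho> k *\<^sub>R gap_grad f g \<gamma>1 \<gamma>2 (x k, y k, z k) + \<nu>"
    and mfcq_lower: "mfcq_ineq (\<lambda>v. g (xbar, v)) ybar"
    and mfcq_upper: "mfcq_ineq G (xbar, ybar)"
    and zbar_nonneg: "0 \<le> zbar"
    and zbar_accumulation: "\<exists>r. strict_mono r \<and> (z \<circ> r) \<longlonglongrightarrow> zbar"
  shows "(bounded (range \<rho>) \<longrightarrow> S_stationary F f G g (xbar, ybar, zbar)) \<and>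
         (filterlim \<rho> at_top sequentially \<and> mpcc_mfcq f G g (xbar, ybar, zbar)
            \<longrightarrow> C_stationary F f G g (xbar, ybar, zbar))"
proof -
  obtain UF where UF: "open UF" "Omega G \<subseteq> UF" "cont_diff_on UF F" using F_C1 by blast
  \<comment> \<open>Each component comes with its own neighbourhood; the index type is finite, so
    the intersection formed below is still open.\<close>
  obtain UG where UG: "\<And>i. open (UG i)" "\<And>i. Omega G \<subseteq> UG i"
    "\<And>i. cont_diff_on (UG i) (\<lambda>w. G w $ i)" "\<And>i. convex_on (UG i) (\<lambda>w. G w $ i)"
    using G_C1_convex by metis
  obtain Uf where Uf: "open Uf" "X_set G \<times> UNIV \<subseteq> Uf" "twice_cont_diff_on Uf f" using f_C2 by blast
  obtain Ug where Ug: "\<And>i. open (Ug i)" "\<And>i. X_set G \<times> UNIV \<subseteq> Ug i"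
    "\<And>i. twice_cont_diff_on (Ug i) (\<lambda>w. g w $ i)"
    using g_C2 by metis
  obtain \<nu> where \<nu>: "\<And>k. \<nu> k \<in> limiting_normal_cone (Omega_plus G) (x k, y k, z k)"
    "\<And>k. \<epsilon> k = (fst (grad F (x k, y k)), snd (grad F (x k, y k)), 0)
               + \<rho> k *\<^sub>R gap_grad f g \<gamma>1 \<gamma>2 (x k, y k, z k) + \<nu> k"
    using approx_stationary by metis
  obtain r where r: "strict_mono r" and zr: "(z \<circ> r) \<longlonglongrightarrow> zbar"
    using zbar_accumulation by blast
  note sub = LIMSEQ_subseq_LIMSEQ[OF _ r]
  \<comment> \<open>The locale is entered along the subsequence for which \<open>z\<close> tends to
    \<open>zbar\<close>; boundedness and divergence of \<open>\<rho>\<close> are inherited by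
    it.\<close>
  interpret gap_sequence F f G g \<gamma>1 \<gamma>2 "x \<circ> r" "y \<circ> r" "z \<circ> r" "\<epsilon> \<circ> r" "\<nu> \<circ> r" "\<rho> \<circ> r"
    xbar ybar zbar "UF \<inter> (\<Inter>i. UG i)" "Uf \<inter> (\<Inter>i. Ug i)"
  proof
    show "open (UF \<inter> (\<Inter>i. UG i))" "open (Uf \<inter> (\<Inter>i. Ug i))"
      using UF(1) UG(1) Uf(1) Ug(1) by (auto intro!: open_Int open_INT)
    show "Omega G \<subseteq> UF \<inter> (\<Inter>i. UG i)" "X_set G \<times> UNIV \<subseteq> Uf \<inter> (\<Inter>i. Ug i)"
      using UF(2) UG(2) Uf(2) Ug(2) by blast+
    show "cont_diff_on (UF \<inter> (\<Inter>i. UG i)) F" by (rule cont_diff_on_subset[OF UF(3)]) blast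
    show "cont_diff_on (UF \<inter> (\<Inter>i. UG i)) (\<lambda>w. G w $ i)" for i
      by (rule cont_diff_on_subset[OF UG(3)]) blast
    show "twice_cont_diff_on (Uf \<inter> (\<Inter>i. Ug i)) f"
      using Uf(3) unfolding twice_cont_diff_on_def by (auto elim!: cont_diff_on_subset)
    show "twice_cont_diff_on (Uf \<inter> (\<Inter>i. Ug i)) (\<lambda>w. g w $ i)" for i
      using Ug(3)[of i] unfolding twice_cont_diff_on_def by (auto elim!: cont_diff_on_subset)
    show "convex (Omega G)" by (rule convex_OmegaI[OF UG(2,4)])
    show "convex_on UNIV (\<lambda>y. f (u, y) + v \<bullet> g (u, y))" if "u \<in> X_set G" "0 \<le> v" for u v
      using that f_convex g_convex by (intro convex_on_add convex_on_inner_nonneg) auto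
    show "(x \<circ> r) \<longlonglongrightarrow> xbar" "(y \<circ> r) \<longlonglongrightarrow> ybar"
      using sub[OF tendsto_fst[OF xy_lim]] sub[OF tendsto_snd[OF xy_lim]] by (simp_all add: o_def)
    show "(\<epsilon> \<circ> r) \<longlonglongrightarrow> 0" by (rule sub[OF eps_lim])
    show "(\<lambda>k. gap f g \<gamma>1 \<gamma>2 ((x \<circ> r) k, (y \<circ> r) k, (z \<circ> r) k)) \<longlonglongrightarrow> 0"
      using sub[OF gap_lim] by (simp add: o_def)
  qed (use gamma_pos rho_pos zr in_Omega_plus \<nu> mfcq_upper in auto)
  show ?thesis
  proof (intro conjI impI)
    assume "bounded (range \<rho>)"
    then have "bounded (range (\<rho> \<circ> r))" by (rule bounded_subset) auto
    then show "S_stationary F f G g (xbar, ybar, zbar)" by (rule S_stationary_limit)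
  next
    assume *: "filterlim \<rho> at_top sequentially \<and> mpcc_mfcq f G g (xbar, ybar, zbar)"
    have "filterlim (\<rho> \<circ> r) at_top sequentially"
      unfolding o_def by (rule filterlim_compose[OF conjunct1[OF *] filterlim_subseq[OF r]])
    then show "C_stationary F f G g (xbar, ybar, zbar)" using * by (intro C_stationary_limit) auto
  qed
qed

end
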